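(* Let $A\in M_n(\mathbb R)$ be generic and such that $1\notin \mathrm{Spec}^a(A)$. Then the degree of $F_A$ is well-defined and it satisfies $$\deg F_A\equiv 1+c^a(A) \pmod 2.$$ Moreover, $\deg F_A=1$ if all aligned values of $A$ are smaller than $1$, and $\deg F_A=0$ if all aligned values of $A$ are larger than $1$.
   Context: $M_n(\mathbb R)$ is the space of real $n\times n$ matrices and $|\cdot|$ denotes the componentwise absolute value on $\mathbb R^n$. For $A\in M_n(\mathbb R)$ let $F_A:\mathbb R^n\to\mathbb R^n$, $F_A(z)=z-A|z|$. $\mathcal S_n$ is the set of sign matrices, i.e. diagonal $n\times n$ matrices with all diagonal entries in $\{-1,+1\}$. An aligned trio of $A$ is a triple $(\lambda,S,v)$ with $\lambda\ge 0$ real, $S\in\mathcal S_n$, $v\in\mathbb R^n_{\ge 0}$, $\|v\|_2=1$, and $SAv=\lambda v$. Then $\lambda$ is called an aligned value of $A$. The aligned spectrum $\mathrm{Spec}^a(A)$ is the set of aligned values of $A$; equivalently $\mathrm{Spec}^a(A)=\{\lambda\ge 0\mid \exists x\in\mathbb R^n\setminus\{0\}: A|x|=\lambda x\}$. $A$ is generic if for every aligned trio $(\lambda,S,v)$ of $A$, $\lambda$ is a simple eigenvalue of $SA$ and $v$ is strictly positive (all entries $>0$). For generic $A$, the multiplicity of an aligned value $\lambda$ is the number of pairs $(S,v)$ such that $(\lambda,S,v)$ is an aligned trio of $A$. The aligned count $c^a(A)$ is the number of aligned values $\lambda>1$ of $A$, counted with multiplicity. If $F_A$ is nondegenerate (i.e.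 $F_A(z)=0$ only for $z=0$), the degree of $F_A$ is $\deg F_A:=\deg \bar F_A$, the topological degree of the continuous map $\bar F_A:\mathbb S^{n-1}\to\mathbb S^{n-1}$, $\bar F_A(x)=F_A(x)/\|F_A(x)\|_2$ (defined via reduced homology if $n=1$). "The degree is well-defined" means that $F_A$ is nondegenerate. *)

theory Defs
  imports
    "HOL-Homology.Brouwer_Degree"
    "HOL-Number_Theory.Cong"
    "Jordan_Normal_Form.Char_Poly"
begin

(* Only the vector and matrix notation of Jordan_Normal_Form is used; the type vec, its
   constructor and the index operator also exist in HOL-Analysis. *)
no_notation vec_nth (infixl "$" 90)
hide_const (open) Finite_Cartesian_Product.vec
hide_const (open) Coset.order

definition abs_vec :: "real vec \<Rightarrow> real vec" where
  "abs_vec z = map_vec abs z"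

definition norm_vec :: "real vec \<Rightarrow> real" where
  "norm_vec v = L2_set (\<lambda>i. v $ i) {..<dim_vec v}"

definition F_map :: "real mat \<Rightarrow> real vec \<Rightarrow> real vec" where
  "F_map A z = z - A *\<^sub>v abs_vec z"

definition sign_matrices :: "nat \<Rightarrow> real mat set" where
  "sign_matrices n =
     {S \<in> carrier_mat n n. diagonal_mat S \<and> (\<forall>i<n. S $$ (i, i) \<in> {-1, 1})}"

(* The matrix A is always assumed to be square, its size being dim_row A.  The order on
   vectors is the componentwise one. *)
definition aligned_trio :: "real mat \<Rightarrow> real \<Rightarrow> real mat \<Rightarrow> real vec \<Rightarrow> bool" where
  "aligned_trio A l S v \<longleftrightarrow>
     0 \<le> l \<and> S \<in> sign_matrices (dim_row A) \<and>
     v \<in> carrier_vec (dim_row A) \<and> 0\<^sub>v (dim_row A) \<le> v \<and> norm_vec v = 1 \<and>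
     (S * A) *\<^sub>v v = l \<cdot>\<^sub>v v"

definition aligned_spectrum :: "real mat \<Rightarrow> real set" where
  "aligned_spectrum A = {l. \<exists>S v. aligned_trio A l S v}"

(* Simple means algebraically simple: a simple root of the characteristic polynomial. *)
definition simple_eigenvalue :: "real mat \<Rightarrow> real \<Rightarrow> bool" where
  "simple_eigenvalue B l \<longleftrightarrow> eigenvalue B l \<and> Polynomial.order l (char_poly B) = 1"

definition generic :: "real mat \<Rightarrow> bool" where
  "generic A \<longleftrightarrow>
     (\<forall>l S v. aligned_trio A l S v \<longrightarrow>
        simple_eigenvalue (S * A) l \<and> (\<forall>i<dim_vec v. 0 < v $ i))"

(* For generic A the sets below are finite: there are finitely many sign matrices S, each S * A
   has finitely many eigenvalues, and for a simple eigenvalue v is determined by S. *)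
definition aligned_multiplicity :: "real mat \<Rightarrow> real \<Rightarrow> nat" where
  "aligned_multiplicity A l = card {(S, v). aligned_trio A l S v}"

definition aligned_count :: "real mat \<Rightarrow> nat" where
  "aligned_count A = (\<Sum>l\<in>{l \<in> aligned_spectrum A. 1 < l}. aligned_multiplicity A l)"

definition nondegenerate :: "real mat \<Rightarrow> bool" where
  "nondegenerate A \<longleftrightarrow>
     (\<forall>z\<in>carrier_vec (dim_row A). F_map A z = 0\<^sub>v (dim_row A) \<longrightarrow> z = 0\<^sub>v (dim_row A))"

definition F_bar :: "real mat \<Rightarrow> real vec \<Rightarrow> real vec" where
  "F_bar A x = (1 / norm_vec (F_map A x)) \<cdot>\<^sub>v F_map A x"

(* The library realises the sphere of dimension n - 1 as nsphere (n - 1), whose points are the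
   unit vectors x :: nat => real supported on {..<n}. *)
definition coords :: "real vec \<Rightarrow> nat \<Rightarrow> real" where
  "coords v = (\<lambda>i. if i < dim_vec v then v $ i else 0)"

definition F_sphere :: "real mat \<Rightarrow> (nat \<Rightarrow> real) \<Rightarrow> nat \<Rightarrow> real" where
  "F_sphere A x = coords (F_bar A (Matrix.vec (dim_row A) x))"

(* Brouwer_degree2 is defined through reduced homology in every dimension, so that the case
   of 1 x 1 matrices is covered. *)
definition deg_F :: "real mat \<Rightarrow> int" where
  "deg_F A = Brouwer_degree2 (dim_row A - 1) (F_sphere A)"

lemma vec_in_topspace_nsphere:
  assumes "0 < n" "v \<in> carrier_vec n" "norm_vec v = 1"
  shows "coords v \<in> topspace (nsphere (n - 1))"
proof -
  have n: "{..n - Suc 0} = {..<n}" using assms(1) by auto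
  have "sqrt (\<Sum>i<n. (v $ i)\<^sup>2) = 1"
    using assms by (simp add: norm_vec_def L2_set_def)
  then have "(\<Sum>i\<le>n - 1. (coords v i)\<^sup>2) = 1"
    using assms(2) by (simp add: n coords_def)
  moreover have "\<forall>i>n - 1. coords v i = 0"
    using assms by (auto simp: coords_def)
  ultimately show ?thesis by (simp add: nsphere)
qed

lemma vec_of_nsphere:
  assumes "0 < n" "x \<in> topspace (nsphere (n - 1))"
  shows "norm_vec (Matrix.vec n x) = 1" "coords (Matrix.vec n x) = x"
proof -
  have n: "{..n - Suc 0} = {..<n}" using assms(1) by auto
  show "norm_vec (Matrix.vec n x) = 1"
    using assms(2) by (simp add: nsphere n norm_vec_def L2_set_def)
  show "coords (Matrix.vec n x) = x"
    using assms by (auto simp: nsphere coords_def)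
qed

(* Brouwer_degree2 returns 0 on maps that are not continuous self-maps of the sphere; this does
   not happen here. *)
lemma continuous_map_F_sphere:
  assumes n: "0 < n" and A: "A \<in> carrier_mat n n" and nd: "nondegenerate A"
  shows "continuous_map (nsphere (n - 1)) (nsphere (n - 1)) (F_sphere A)"
proof -
  define f where "f x i = x i - (\<Sum>j<n. A $$ (i, j) * \<bar>x j\<bar>)" for x :: "nat \<Rightarrow> real" and i
  define N where "N x = L2_set (f x) {..<n}" for x
  have dr: "dim_row A = n" "dim_col A = n" using A by auto
  have Fi: "F_map A (Matrix.vec n x) $ i = f x i" if "i < n" for x i
    using that dr by (simp add: F_map_def abs_vec_def map_vec_def f_def scalar_prod_def
        atLeast0LessThan)
  have Fd: "F_map A (Matrix.vec n x) \<in> carrier_vec n" for x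
    using A by (auto simp: F_map_def abs_vec_def map_vec_def)
  have FN: "norm_vec (F_map A (Matrix.vec n x)) = N x" for x
    using Fd[of x] by (simp add: norm_vec_def N_def L2_set_def Fi)
  have N0: "N x \<noteq> 0" if x: "x \<in> topspace (nsphere (n - 1))" for x
  proof
    assume "N x = 0"
    then have "f x i = 0" if "i < n" for i
      using that by (simp add: N_def L2_set_eq_0_iff)
    then have "F_map A (Matrix.vec n x) = 0\<^sub>v n"
      using Fd[of x] by (intro eq_vecI) (auto simp: Fi)
    then have "Matrix.vec n x = 0\<^sub>v n"
      using nd dr by (simp add: nondegenerate_def)
    then show False
      using vec_of_nsphere(1)[OF n x] by (simp add: norm_vec_def L2_set_def)
  qed
  have S: "F_sphere A x = (\<lambda>i. if i < n then f x i / N x else 0)" for x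
    using Fd[of x] by (auto simp: F_sphere_def F_bar_def coords_def dr FN Fi)
  have proj: "continuous_map (nsphere (n - 1)) euclideanreal (\<lambda>x. x i)" for i
    unfolding nsphere
    by (intro continuous_map_from_subtopology continuous_map_product_projection) simp
  have cf: "continuous_map (nsphere (n - 1)) euclideanreal (\<lambda>x. f x i)" for i
    unfolding f_def
    by (intro continuous_map_diff continuous_map_sum continuous_map_real_mult
        continuous_map_real_abs continuous_map_canonical_const proj) auto
  have cN: "continuous_map (nsphere (n - 1)) euclideanreal N"
    unfolding N_def L2_set_def
    by (intro continuous_map_sqrt continuous_map_sum continuous_map_real_pow cf) auto
  have "continuous_map (nsphere (n - 1)) euclideanreal (\<lambda>x. F_sphere A x i)" for i
  proof (cases "i < n")
    case True
    then show ?thesis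
      unfolding S using continuous_map_real_divide[OF cf cN N0] by simp
  next
    case False
    then show ?thesis unfolding S by simp
  qed
  then have "continuous_map (nsphere (n - 1)) (powertop_real UNIV) (F_sphere A)"
    by (simp add: continuous_map_componentwise_UNIV)
  moreover have "F_sphere A x \<in> topspace (nsphere (n - 1))"
    if x: "x \<in> topspace (nsphere (n - 1))" for x
  proof -
    have "(N x)\<^sup>2 = (\<Sum>i<n. (f x i)\<^sup>2)"
      by (simp add: N_def L2_set_def sum_nonneg)
    moreover have "(\<Sum>i<n. (f x i / N x)\<^sup>2) = (\<Sum>i<n. (f x i)\<^sup>2) / (N x)\<^sup>2"
      by (simp only: power_divide sum_divide_distrib)
    ultimately have "(\<Sum>i<n. (f x i / N x)\<^sup>2) = 1"
      using N0[OF x] by (metis divide_self power_not_zero)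
    moreover have "{..n - Suc 0} = {..<n}" using n by auto
    moreover have "(\<Sum>i<n. (F_sphere A x i)\<^sup>2) = (\<Sum>i<n. (f x i / N x)\<^sup>2)"
      by (intro sum.cong) (simp_all add: S)
    moreover have "\<forall>i>n - Suc 0. F_sphere A x i = 0"
      unfolding S using n by auto
    ultimately show ?thesis by (simp add: nsphere)
  qed
  moreover have "continuous_map (nsphere (n - 1)) (nsphere (n - 1)) g"
    if "continuous_map (nsphere (n - 1)) (powertop_real UNIV) g"
      "\<And>x. x \<in> topspace (nsphere (n - 1)) \<Longrightarrow> g x \<in> topspace (nsphere (n - 1))" for g
  proof -
    have "continuous_map (nsphere (n - 1))
        (subtopology (powertop_real UNIV) (topspace (nsphere (n - 1)))) g"
      using that by (intro continuous_map_into_subtopology) auto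
    then show ?thesis by (simp add: nsphere)
  qed
  ultimately show ?thesis by blast
qed

end

theory Submission
  imports Defs
begin

text \<open>For a continuous \<open>\<mu>\<close> on the sphere consider the field \<open>\<mu> x x - A|x|\<close>, which is \<open>F\<^sub>A\<close> for \<open>\<mu> = 1\<close>. It
  vanishes exactly at the unit vectors \<open>z\<close> with \<open>A|z| = \<mu> z z\<close>, so for positive \<open>\<mu>\<close> its degree depends
  only on the set of the finitely many aligned directions \<open>z\<close> (unit vectors with \<open>A|z| = l z\<close>, \<open>l > 0\<close>)
  at which \<open>\<mu> z < l\<close>. If this set is empty, the field is homotopic to the identity and the degree is \<open>1\<close>.
  Removing one \<open>z\<close> from the set changes the degree by \<open>\<plusminus>1\<close>: locally the field is \<open>\<mu> x x - B x\<close> with \<open>B\<close>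
  linear and \<open>l\<close> a simple eigenvalue of \<open>B\<close>, and by a Mayer-Vietoris argument on chains the change can be
  computed for this global field instead. For \<open>\<mu> = 1\<close> the set is the one counted by the aligned count.
  If all aligned values exceed \<open>1\<close>, then \<open>\<mu>\<close> can be moved from \<open>1\<close> to \<open>0\<close>, and \<open>-A|x|\<close> stays in a half space.\<close>

subsection \<open>Exchanging local modifications of sphere maps\<close>

text \<open>Lets a cycle be replaced, within its homology class, by a subdivision fine enough to be
  split in two.\<close>

lemma homologous_rel_iterated_subdivision:
  assumes "singular_relcycle p X S c"
  shows "homologous_rel p X S c ((singular_subdivision p ^^ n) c)"
proof (induction n)
  case (Suc n)
  then show ?case
    using assms
    by simp (metis homologous_rel_eq homologous_rel_singular_relcycle_1 homologous_rel_singular_subdivision)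
qed auto

text \<open>If \<open>f1, f2\<close> differ only where they equal \<open>f3, f4\<close>, then both pairs have the same
  difference in homology: after subdivision a cycle is a sum of a chain in \<open>T\<close>, where
  \<open>f1 = f3\<close> and \<open>f2 = f4\<close>, and a chain off \<open>U\<close>, where \<open>f1 = f2\<close> and \<open>f3 = f4\<close>.\<close>

lemma hom_induced_exchange:
  assumes cont: "continuous_map X Y f1" "continuous_map X Y f2"
      "continuous_map X Y f3" "continuous_map X Y f4"
    and T: "\<And>x. x \<in> topspace X \<Longrightarrow> x \<in> T \<Longrightarrow> f1 x = f3 x \<and> f2 x = f4 x"
    and U: "\<And>x. x \<in> topspace X \<Longrightarrow> x \<notin> U \<Longrightarrow> f1 x = f2 x \<and> f3 x = f4 x"
    and UT: "X closure_of U \<subseteq> X interior_of T"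
    and a: "a \<in> carrier (homology_group (int p) X)"
  shows "hom_induced (int p) X {} Y {} f1 a \<otimes>\<^bsub>homology_group (int p) Y\<^esub> hom_induced (int p) X {} Y {} f4 a
       = hom_induced (int p) X {} Y {} f2 a \<otimes>\<^bsub>homology_group (int p) Y\<^esub> hom_induced (int p) X {} Y {} f3 a"
proof -
  obtain c0 where c0: "singular_relcycle p X {} c0" and a0: "a = homologous_rel_set p X {} c0"
    using a by (auto simp: carrier_relative_homology_group)
  have "singular_chain p (subtopology X (topspace X)) c0"
    using c0 by (simp add: singular_relcycle)
  then obtain n d e where d: "singular_chain p (subtopology X (topspace X - U)) d"
    and e: "singular_chain p (subtopology X (topspace X \<inter> T)) e"
    and de: "(singular_subdivision p ^^ n) c0 = d + e"
    using excised_chain_exists[of X U "topspace X \<inter> T" "topspace X" p c0] UT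
    by (metis inf_le1 interior_of_restrict)
  define c where "c = d + e"
  have c: "singular_relcycle p X {} c" and ac: "a = homologous_rel_set p X {} c"
    unfolding c_def using homologous_rel_iterated_subdivision[OF c0, of n] c0 a0
    by (metis de homologous_rel_singular_relcycle, metis de homologous_rel_set_eq)
  let ?H = "homologous_rel_set p Y {}"
  have ind: "hom_induced (int p) X {} Y {} f a = ?H (chain_map p f c)"
    and cyc: "singular_relcycle p Y {} (chain_map p f c)"
    if "continuous_map X Y f" for f
    using that c ac by (auto simp: hom_induced_chain_map singular_relcycle_chain_map)
  have mult: "?H x \<otimes>\<^bsub>homology_group (int p) Y\<^esub> ?H y = ?H (x + y)"
    if "singular_relcycle p Y {} x" "singular_relcycle p Y {} y" for x y
  proof -
    interpret N: normal "singular_relboundary_set p Y {}" "relcycle_group p Y {}"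
      by (rule normal_subgroup_singular_relboundary_relcycle)
    show ?thesis
      using N.rcos_sum[of x y] that
      by (simp add: nontrivial_relative_homology_group FactGroup_def right_coset_singular_relboundary)
  qed
  have "chain_map p f1 d = chain_map p f2 d" "chain_map p f3 d = chain_map p f4 d"
    using U by (auto intro!: chain_map_eq[OF d])
  moreover have "chain_map p f1 e = chain_map p f3 e" "chain_map p f2 e = chain_map p f4 e"
    using T by (auto intro!: chain_map_eq[OF e])
  \<comment> \<open>Both sides are \<open>f2 d + f3 e + f3 d + f2 e\<close> in terms of chain maps,
    so equality holds for chains already, before passing to homology classes.\<close>
  ultimately have "chain_map p f1 c + chain_map p f4 c = chain_map p f2 c + chain_map p f3 c"
    by (simp add: c_def chain_map_add)
  then show ?thesis
    by (simp add: ind mult cyc cont)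
qed

text \<open>A map sends a generator \<open>a\<close> of the infinite cyclic reduced homology group
  to the power given by its degree, so the exchange identity at \<open>a\<close> becomes one of
  exponents. Here \<open>ord a = 0\<close> means infinite order, and the reduced group lies in the
  homology group with the same product.\<close>

lemma Brouwer_degree2_exchange:
  assumes cont: "continuous_map (nsphere p) (nsphere p) f1" "continuous_map (nsphere p) (nsphere p) f2"
      "continuous_map (nsphere p) (nsphere p) f3" "continuous_map (nsphere p) (nsphere p) f4"
    and T: "\<And>x. x \<in> topspace (nsphere p) \<Longrightarrow> x \<in> T \<Longrightarrow> f1 x = f3 x \<and> f2 x = f4 x"
    and U: "\<And>x. x \<in> topspace (nsphere p) \<Longrightarrow> x \<notin> U \<Longrightarrow> f1 x = f2 x \<and> f3 x = f4 x"
    and UT: "nsphere p closure_of U \<subseteq> nsphere p interior_of T"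
  shows "Brouwer_degree2 p f1 - Brouwer_degree2 p f2 = Brouwer_degree2 p f3 - Brouwer_degree2 p f4"
proof -
  let ?G = "reduced_homology_group (int p) (nsphere p)"
  interpret group ?G by simp
  obtain a where a: "a \<in> carrier ?G" and aeq: "subgroup_generated ?G {a} = ?G"
    using cyclic_reduced_homology_group_nsphere [of p p] by (auto simp: cyclic_group_def)
  have ord: "ord a = 0"
    by (simp add: a aeq iso_finite [OF reduced_homology_group_nsphere(1)] flip: infinite_cyclic_subgroup_order)
  have aH: "a \<in> carrier (homology_group (int p) (nsphere p))"
    using a carrier_reduced_homology_group_subset by blast
  have mult: "(\<otimes>\<^bsub>homology_group (int p) (nsphere p)\<^esub>) = (\<otimes>\<^bsub>?G\<^esub>)"
    by (simp add: reduced_homology_group_def)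
  have "a [^]\<^bsub>?G\<^esub> (Brouwer_degree2 p f1 + Brouwer_degree2 p f4)
      = a [^]\<^bsub>?G\<^esub> (Brouwer_degree2 p f2 + Brouwer_degree2 p f3)"
    using hom_induced_exchange[OF cont T U UT aH] a
    by (simp add: Brouwer_degree2 int_pow_mult mult)
  then have "Brouwer_degree2 p f1 + Brouwer_degree2 p f4 = Brouwer_degree2 p f2 + Brouwer_degree2 p f3"
    using a ord by (simp add: int_pow_eq)
  then show ?thesis by simp
qed

subsection \<open>Degree of a nonvanishing field\<close>

text \<open>Cut off at \<open>n\<close> because points of the sphere are functions supported on
  \<open>{..<n}\<close>. A vector that vanishes there goes to 0, by division by zero.\<close>

definition normalized :: "nat \<Rightarrow> (nat \<Rightarrow> real) \<Rightarrow> nat \<Rightarrow> real" where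
  "normalized n v = (\<lambda>i. if i < n then v i / L2_set v {..<n} else 0)"

lemma topspace_nsphere_less:
  assumes "0 < n"
  shows "topspace (nsphere (n - 1)) = {x. (\<Sum>i<n. (x i)\<^sup>2) = 1 \<and> (\<forall>i\<ge>n. x i = 0)}"
proof -
  \<comment> \<open>For \<open>n = 0\<close> this would fail, as \<open>n - 1\<close> is truncated
    to 0.\<close>
  have "{..n - Suc 0} = {..<n}" using assms by auto
  then show ?thesis using assms by (auto simp: nsphere Suc_le_eq)
qed

lemma L2_set_pos:
  fixes n :: nat
  assumes "\<exists>i<n. v i \<noteq> 0"
  shows "0 < L2_set v {..<n}"
  using assms L2_set_nonneg[of v "{..<n}"] by (force simp: less_le L2_set_eq_0_iff)

lemma normalized_in_nsphere:
  assumes "\<exists>i<n. v i \<noteq> 0"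
  shows "normalized n v \<in> topspace (nsphere (n - 1))"
proof -
  have n: "0 < n" using assms by auto
  have "(L2_set v {..<n})\<^sup>2 = (\<Sum>i<n. (v i)\<^sup>2)"
    by (simp add: L2_set_def sum_nonneg)
  then have "(\<Sum>i<n. (v i / L2_set v {..<n})\<^sup>2) = 1"
    using L2_set_pos[OF assms] by (simp add: power_divide flip: sum_divide_distrib)
      (metis divide_self less_irrefl power_not_zero)
  then show ?thesis
    unfolding topspace_nsphere_less[OF n] by (simp add: normalized_def)
qed

lemma normalized_scale:
  assumes "0 < c"
  shows "normalized n (\<lambda>i. c * v i) = normalized n v"
proof -
  have "L2_set (\<lambda>i. c * v i) {..<n} = c * L2_set v {..<n}"
    using assms by (simp add: L2_set_right_distrib)
  then show ?thesis using assms by (auto simp: normalized_def)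
qed

lemma normalized_cong: "(\<And>i. i < n \<Longrightarrow> v i = w i) \<Longrightarrow> normalized n v = normalized n w"
  by (auto simp: normalized_def intro!: ext arg_cong2[where f = "(/)"] L2_set_cong)

lemma normalized_on_nsphere:
  assumes "0 < n" "x \<in> topspace (nsphere (n - 1))"
  shows "normalized n x = x"
proof -
  have "L2_set x {..<n} = 1"
    using assms(2) unfolding topspace_nsphere_less[OF assms(1)] by (simp add: L2_set_def)
  then show ?thesis
    using assms(2) unfolding topspace_nsphere_less[OF assms(1)] by (auto simp: normalized_def)
qed

text \<open>The domain \<open>Z\<close> is arbitrary so that homotopies, which live on an interval
  times the sphere, are covered as well.\<close>

lemma continuous_map_normalized:
  assumes n: "0 < n"
    and cont: "\<And>i. i < n \<Longrightarrow> continuous_map Z euclideanreal (\<lambda>z. g z i)"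
    and nz: "\<And>z. z \<in> topspace Z \<Longrightarrow> \<exists>i<n. g z i \<noteq> 0"
  shows "continuous_map Z (nsphere (n - 1)) (\<lambda>z. normalized n (g z))"
proof -
  have cN: "continuous_map Z euclideanreal (\<lambda>z. L2_set (g z) {..<n})"
    unfolding L2_set_def
    by (intro continuous_map_sqrt continuous_map_sum continuous_map_real_pow cont) auto
  have N0: "L2_set (g z) {..<n} \<noteq> 0" if "z \<in> topspace Z" for z
    using L2_set_pos[OF nz[OF that]] by simp
  have "continuous_map Z euclideanreal (\<lambda>z. normalized n (g z) i)" for i
    using continuous_map_real_divide[OF cont cN N0] by (cases "i < n") (simp_all add: normalized_def)
  then have "continuous_map Z (powertop_real UNIV) (\<lambda>z. normalized n (g z))"
    by (simp add: continuous_map_componentwise_UNIV)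
  moreover have "normalized n (g z) \<in> topspace (nsphere (n - 1))" if "z \<in> topspace Z" for z
    by (rule normalized_in_nsphere[OF nz[OF that]])
  ultimately have "continuous_map Z
      (subtopology (powertop_real UNIV) (topspace (nsphere (n - 1)))) (\<lambda>z. normalized n (g z))"
    by (intro continuous_map_into_subtopology) auto
  then show ?thesis by (simp add: nsphere)
qed

lemma continuous_map_nsphere_coordinate:
  "continuous_map (nsphere p) euclideanreal (\<lambda>x. x i)"
  unfolding nsphere
  by (intro continuous_map_from_subtopology continuous_map_product_projection) simp

definition nonvanishing_field :: "nat \<Rightarrow> ((nat \<Rightarrow> real) \<Rightarrow> nat \<Rightarrow> real) \<Rightarrow> bool" where
  "nonvanishing_field n G \<longleftrightarrow> 0 < n \<and>
     (\<forall>i<n. continuous_map (nsphere (n - 1)) euclideanreal (\<lambda>x. G x i)) \<and>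
     (\<forall>x\<in>topspace (nsphere (n - 1)). \<exists>i<n. G x i \<noteq> 0)"

text \<open>Meaningful for nonvanishing fields only: otherwise the normalized map may leave the
  sphere, and \<open>Brouwer_degree2\<close> then has a default value.\<close>

definition field_degree :: "nat \<Rightarrow> ((nat \<Rightarrow> real) \<Rightarrow> nat \<Rightarrow> real) \<Rightarrow> int" where
  "field_degree n G = Brouwer_degree2 (n - 1) (\<lambda>x. normalized n (G x))"

lemma continuous_map_field:
  assumes "nonvanishing_field n G"
  shows "continuous_map (nsphere (n - 1)) (nsphere (n - 1)) (\<lambda>x. normalized n (G x))"
  using assms by (intro continuous_map_normalized) (auto simp: nonvanishing_field_def)

text \<open>The segments from \<open>G x\<close> to \<open>H x\<close> avoid the origin, so they can
  be normalized to a homotopy of sphere maps.\<close>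

lemma field_degree_homotopic:
  assumes G: "nonvanishing_field n G" and H: "nonvanishing_field n H"
    and nz: "\<And>t x. \<lbrakk>0 \<le> t; t \<le> 1; x \<in> topspace (nsphere (n - 1))\<rbrakk>
                \<Longrightarrow> \<exists>i<n. (1 - t) * G x i + t * H x i \<noteq> 0"
  shows "field_degree n G = field_degree n H"
proof -
  let ?I = "top_of_set {0..1::real}" and ?S = "nsphere (n - 1)"
  have n: "0 < n" using G by (simp add: nonvanishing_field_def)
  define h where "h = (\<lambda>z :: real \<times> (nat \<Rightarrow> real).
    normalized n (\<lambda>i. (1 - fst z) * G (snd z) i + fst z * H (snd z) i))"
  have fst: "continuous_map (prod_topology ?I ?S) euclideanreal fst"
    using continuous_map_fst[of ?I ?S] continuous_map_in_subtopology by blast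
  have snd: "continuous_map (prod_topology ?I ?S) euclideanreal (\<lambda>z. K (snd z) i)"
    if "nonvanishing_field n K" "i < n" for K i
    using that continuous_map_compose[OF continuous_map_snd[of ?I ?S]]
    by (fastforce simp: nonvanishing_field_def o_def)
  have "continuous_map (prod_topology ?I ?S) ?S h"
    unfolding h_def
  proof (rule continuous_map_normalized[OF n])
    fix i assume "i < n"
    then show "continuous_map (prod_topology ?I ?S) euclideanreal
        (\<lambda>z. (1 - fst z) * G (snd z) i + fst z * H (snd z) i)"
      by (intro continuous_map_add continuous_map_real_mult continuous_map_diff fst
          snd[OF G] snd[OF H] continuous_map_canonical_const)
  qed (use nz in auto)
  moreover have "h (0, x) = normalized n (G x)" "h (1, x) = normalized n (H x)" for x
    by (simp_all add: h_def)
  ultimately have "homotopic_with (\<lambda>x. True) ?S ?S (\<lambda>x. normalized n (G x)) (\<lambda>x. normalized n (H x))"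
    by (auto simp: homotopic_with_def)
  then show ?thesis
    unfolding field_degree_def by (rule Brouwer_degree2_homotopic)
qed

lemma field_degree_cong:
  assumes "\<And>x i. \<lbrakk>x \<in> topspace (nsphere (n - 1)); i < n\<rbrakk> \<Longrightarrow> G x i = H x i"
  shows "field_degree n G = field_degree n H"
  unfolding field_degree_def using assms by (intro Brouwer_degree2_eq normalized_cong) auto

lemma field_degree_id:
  assumes "0 < n"
  shows "field_degree n (\<lambda>x. x) = 1"
proof -
  have "field_degree n (\<lambda>x. x) = Brouwer_degree2 (n - 1) id"
    unfolding field_degree_def using normalized_on_nsphere[OF assms] by (intro Brouwer_degree2_eq) auto
  then show ?thesis by simp
qed

text \<open>The direction of \<open>q\<close> has positive inner product with \<open>q\<close> and
  is therefore missed; a map that is not onto has degree 0.\<close>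

lemma field_degree_half_space:
  assumes G: "nonvanishing_field n G" and q: "\<exists>i<n. q i \<noteq> 0"
    and neg: "\<And>x. x \<in> topspace (nsphere (n - 1)) \<Longrightarrow> (\<Sum>i<n. q i * G x i) \<le> 0"
  shows "field_degree n G = 0"
  unfolding field_degree_def
proof (rule Brouwer_degree2_nonsurjective[OF continuous_map_field[OF G]])
  have "normalized n (G x) \<noteq> normalized n q" if x: "x \<in> topspace (nsphere (n - 1))" for x
  proof
    assume eq: "normalized n (G x) = normalized n q"
    let ?a = "L2_set (G x) {..<n}" and ?b = "L2_set q {..<n}"
    have a: "0 < ?a"
      using G x by (intro L2_set_pos) (auto simp: nonvanishing_field_def)
    have b: "0 < ?b" by (rule L2_set_pos[OF q])
    have "(\<Sum>i<n. q i * G x i) / ?a = (\<Sum>i<n. q i * normalized n (G x) i)"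
      by (simp add: normalized_def sum_divide_distrib)
    also have "\<dots> = (\<Sum>i<n. (q i)\<^sup>2) / ?b"
      unfolding eq by (simp add: normalized_def sum_divide_distrib power2_eq_square)
    also have "(\<Sum>i<n. (q i)\<^sup>2) = ?b\<^sup>2"
      by (simp add: L2_set_def sum_nonneg)
    finally have "0 < (\<Sum>i<n. q i * G x i) / ?a"
      using b by simp
    then show False
      using neg[OF x] a by (simp add: zero_less_divide_iff)
  qed
  moreover have "normalized n q \<in> topspace (nsphere (n - 1))"
    by (rule normalized_in_nsphere[OF q])
  ultimately show "(\<lambda>x. normalized n (G x)) ` topspace (nsphere (n - 1)) \<noteq> topspace (nsphere (n - 1))"
    by (metis imageE)
qed

section \<open>Linear isomorphisms as fields on the sphere\<close>

lemma nonzero_on_nsphere: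
  assumes "0 < n" "x \<in> topspace (nsphere (n - 1))"
  shows "\<exists>i<n. x i \<noteq> 0"
proof (rule ccontr)
  assume "\<not> ?thesis"
  then have "(\<Sum>i<n. (x i)\<^sup>2) = 0" by (intro sum.neutral) auto
  then show False using assms(2) unfolding topspace_nsphere_less[OF assms(1)] by simp
qed

lemma linear_field:
  fixes M N :: "nat \<Rightarrow> nat \<Rightarrow> real"
  assumes n: "0 < n"
    and NM: "\<And>i k. \<lbrakk>i < n; k < n\<rbrakk> \<Longrightarrow> (\<Sum>j<n. N i j * M j k) = (if i = k then 1 else 0)"
  shows "nonvanishing_field n (\<lambda>x i. \<Sum>j<n. M i j * x j)"
    and "\<And>x i. i < n \<Longrightarrow> (\<Sum>j<n. N i j * (\<Sum>k<n. M j k * x k)) = x i"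
proof -
  show *: "(\<Sum>j<n. N i j * (\<Sum>k<n. M j k * x k)) = x i" if "i < n" for x i
  proof -
    have "(\<Sum>j<n. N i j * (\<Sum>k<n. M j k * x k)) = (\<Sum>k<n. \<Sum>j<n. N i j * M j k * x k)"
      unfolding sum_distrib_left by (subst sum.swap) (simp add: mult.assoc)
    also have "\<dots> = (\<Sum>k<n. (if i = k then 1 else 0) * x k)"
      using NM[OF that] by (intro sum.cong) (simp_all flip: sum_distrib_right)
    also have "\<dots> = (\<Sum>k<n. if i = k then x k else 0)"
      by (intro sum.cong) auto
    also have "\<dots> = x i"
      using that by simp
    finally show ?thesis .
  qed
  have "\<exists>i<n. (\<Sum>j<n. M i j * x j) \<noteq> 0" if x: "x \<in> topspace (nsphere (n - 1))" for x
  proof (rule ccontr)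
    assume "\<not> ?thesis"
    then have "(\<Sum>j<n. N i j * (\<Sum>k<n. M j k * x k)) = 0" for i
      by (intro sum.neutral) auto
    then show False
      using * nonzero_on_nsphere[OF n x] by metis
  qed
  then show "nonvanishing_field n (\<lambda>x i. \<Sum>j<n. M i j * x j)"
    unfolding nonvanishing_field_def using n
    by (auto intro!: continuous_map_sum continuous_map_real_mult continuous_map_nsphere_coordinate)
qed

text \<open>Normalization forgets positive factors, so the normalized maps of \<open>M\<close> and
  of its inverse \<open>N\<close> are inverse to each other. Homeomorphisms of the sphere have
  degree 1 or -1.\<close>

lemma field_degree_linear:
  fixes M N :: "nat \<Rightarrow> nat \<Rightarrow> real"
  assumes n: "0 < n"
    and NM: "\<And>i k. \<lbrakk>i < n; k < n\<rbrakk> \<Longrightarrow> (\<Sum>j<n. N i j * M j k) = (if i = k then 1 else 0)"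
    and MN: "\<And>i k. \<lbrakk>i < n; k < n\<rbrakk> \<Longrightarrow> (\<Sum>j<n. M i j * N j k) = (if i = k then 1 else 0)"
  shows "\<bar>field_degree n (\<lambda>x i. \<Sum>j<n. M i j * x j)\<bar> = 1"
proof -
  let ?f = "\<lambda>M :: nat \<Rightarrow> nat \<Rightarrow> real. \<lambda>x. normalized n (\<lambda>i. \<Sum>j<n. M i j * x j)"
  have inv: "?f N (?f M x) = x"
    if x: "x \<in> topspace (nsphere (n - 1))"
      and NM: "\<And>i k. \<lbrakk>i < n; k < n\<rbrakk> \<Longrightarrow> (\<Sum>j<n. N i j * M j k) = (if i = k then 1 else 0)"
    for M N :: "nat \<Rightarrow> nat \<Rightarrow> real" and x
  proof -
    define c where "c = 1 / L2_set (\<lambda>i. \<Sum>j<n. M i j * x j) {..<n}"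
    have c: "0 < c"
      unfolding c_def using linear_field(1)[of n N M, OF n NM] x
      by (intro divide_pos_pos L2_set_pos) (auto simp: nonvanishing_field_def)
    have "?f N (?f M x) = normalized n (\<lambda>i. c * x i)"
    proof (rule normalized_cong)
      fix i assume "i < n"
      have "(\<Sum>j<n. N i j * ?f M x j) = (\<Sum>j<n. c * (N i j * (\<Sum>k<n. M j k * x k)))"
        by (intro sum.cong) (simp_all add: normalized_def c_def)
      also have "\<dots> = c * x i"
        using linear_field(2)[of n N M, OF n NM \<open>i < n\<close>] by (simp flip: sum_distrib_left)
      finally show "(\<Sum>j<n. N i j * ?f M x j) = c * x i" .
    qed
    also have "\<dots> = x"
      using normalized_scale[OF c] normalized_on_nsphere[OF n x] by simp
    finally show ?thesis .
  qed
  have "homeomorphic_maps (nsphere (n - 1)) (nsphere (n - 1)) (?f M) (?f N)"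
    unfolding homeomorphic_maps_def
    using continuous_map_field[OF linear_field(1)[of n N M, OF n NM]]
      continuous_map_field[OF linear_field(1)[of n M N, OF n MN]] inv NM MN
    by auto
  then show ?thesis
    unfolding field_degree_def by (rule Brouwer_degree2_homeomorphic_maps) auto
qed

subsection \<open>Simple eigenvalues\<close>

lemma char_matrix_inverse:
  fixes B :: "real mat"
  assumes B: "B \<in> carrier_mat n n" and ev: "poly (char_poly B) m \<noteq> 0"
  obtains Z where "Z \<in> carrier_mat n n" "Z * (m \<cdot>\<^sub>m 1\<^sub>m n - B) = 1\<^sub>m n" "(m \<cdot>\<^sub>m 1\<^sub>m n - B) * Z = 1\<^sub>m n"
proof -
  let ?K = "m \<cdot>\<^sub>m 1\<^sub>m n - B"
  have K: "?K \<in> carrier_mat n n" using B by auto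
  \<comment> \<open>\<open>char_matrix B m\<close> is \<open>B\<close> minus \<open>m\<close> times
    the identity, whence the sign.\<close>
  have "- char_matrix B m = ?K"
    using B by (intro eq_matI) (auto simp: char_matrix_def)
  then have "det ?K \<noteq> 0"
    using ev char_poly_matrix[OF B, of m] by simp
  from det_non_zero_imp_unit[OF K this, of "()"] show ?thesis
    using that by (auto simp: Units_def ring_mat_def)
qed

text \<open>Brauer's deflation: \<open>W\<close> is \<open>p w\<^sup>T\<close> with \<open>w = e\<^sub>0 / p\<^sub>0\<close>, so that adding it moves the eigenvalue \<open>l\<close>
  of \<open>p\<close> to \<open>l + 1\<close> and keeps the others. The choice of \<open>w\<close> makes \<open>1 - c W\<close> triangular.\<close>

lemma simple_root_deflation:
  fixes B :: "real mat"
  assumes n: "0 < n" and B: "B \<in> carrier_mat n n" and p: "p \<in> carrier_vec n" and p0: "p $ 0 \<noteq> 0"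
    and ev: "B *\<^sub>v p = l \<cdot>\<^sub>v p" and ord: "Polynomial.order l (char_poly B) = 1"
  defines "W \<equiv> mat n n (\<lambda>(i, j). if j = 0 then p $ i / p $ 0 else 0)"
  shows "poly (char_poly (B + W)) l \<noteq> 0"
proof -
  have W: "W \<in> carrier_mat n n" by (simp add: W_def)
  have BW: "B * W = l \<cdot>\<^sub>m W"
  proof (rule eq_matI)
    fix i j assume ij: "i < dim_row (l \<cdot>\<^sub>m W)" "j < dim_col (l \<cdot>\<^sub>m W)"
    have "(B *\<^sub>v p) $ i = (l \<cdot>\<^sub>v p) $ i" by (simp add: ev)
    then have "(\<Sum>k<n. B $$ (i, k) * p $ k) = l * p $ i"
      using ij B p W by (simp add: scalar_prod_def atLeast0LessThan)
    then have "(\<Sum>k<n. B $$ (i, k) * (p $ k / p $ 0)) = l * (p $ i / p $ 0)"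
      by (metis (no_types, lifting) sum.cong sum_divide_distrib times_divide_eq_right)
    then show "(B * W) $$ (i, j) = (l \<cdot>\<^sub>m W) $$ (i, j)"
      using ij B by (auto simp: W_def scalar_prod_def atLeast0LessThan)
  qed (use B W in auto)
  \<comment> \<open>Since \<open>B * W\<close> is \<open>l\<close> times \<open>W\<close>, the
    matrix x - (B + W) factors as (x - B)(1 - W/(x - l)). The second factor is lower triangular,
    with diagonal entry 1 - 1/(x - l) at index 0 and 1 elsewhere.\<close>
  have det_eq: "poly (char_poly (B + W)) x * (x - l) = (x - l - 1) * poly (char_poly B) x" if x: "x \<noteq> l" for x
  proof -
    define E where "E = 1\<^sub>m n - (1 / (x - l)) \<cdot>\<^sub>m W"
    let ?K = "x \<cdot>\<^sub>m 1\<^sub>m n - B"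
    have E: "E \<in> carrier_mat n n" and K: "?K \<in> carrier_mat n n"
      using W B by (auto simp: E_def)
    have "?K * W = (x - l) \<cdot>\<^sub>m W"
      using B W by (simp add: minus_mult_distrib_mat[of _ n n] BW) (intro eq_matI; simp add: algebra_simps)
    then have "?K * ((1 / (x - l)) \<cdot>\<^sub>m W) = W"
      using x K W by (simp add: mult_smult_distrib[OF K W]) (intro eq_matI; simp)
    then have KE: "?K * E = x \<cdot>\<^sub>m 1\<^sub>m n - (B + W)"
      unfolding E_def using B W by (subst mult_minus_distrib_mat[OF K]) (auto intro!: eq_matI)
    have diag: "diag_mat E = map (\<lambda>i. if i = 0 then 1 - 1 / (x - l) else 1) [0..<n]"
      using n p0 by (auto simp: diag_mat_def E_def W_def)
    have "det E = prod_list (diag_mat E)"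
      by (rule det_lower_triangular[OF _ E]) (auto simp: E_def W_def)
    also have "\<dots> = 1 - 1 / (x - l)"
      using n unfolding diag by (simp flip: prod.distinct_set_conv_list)
    finally have dE: "det E = (x - l - 1) / (x - l)" using x by (simp add: field_simps)
    have cm: "poly (char_poly C) x = det (x \<cdot>\<^sub>m 1\<^sub>m n - C)" if C: "C \<in> carrier_mat n n" for C
    proof -
      have "- char_matrix C x = x \<cdot>\<^sub>m 1\<^sub>m n - C"
        using C by (intro eq_matI) (auto simp: char_matrix_def)
      then show ?thesis by (simp add: char_poly_matrix[OF C])
    qed
    have "poly (char_poly (B + W)) x = det (?K * E)"
      using cm[of "B + W"] B W by (simp add: KE)
    also have "\<dots> = poly (char_poly B) x * ((x - l - 1) / (x - l))"
      by (simp add: det_mult[OF K E] dE cm[OF B])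
    finally show ?thesis using x by simp
  qed
  have nz: "char_poly B \<noteq> 0"
    using degree_monic_char_poly[OF B] n by auto
  obtain g where g: "char_poly B = [:- l, 1:] * g" and gl: "poly g l \<noteq> 0"
    using order_decomp[OF nz, of l] ord poly_eq_0_iff_dvd[of g l for g] by auto
  \<comment> \<open>The comparison of determinants excludes \<open>x = l\<close>, but polynomials
    that agree at infinitely many points are equal. At \<open>l\<close> the right-hand one has the
    value \<open>- poly g l\<close>, nonzero by simplicity of the root.\<close>
  have "poly (char_poly (B + W) - [:- l - 1, 1:] * g) x = 0" if "x \<noteq> l" for x
  proof -
    have "(x - l) * poly (char_poly (B + W) - [:- l - 1, 1:] * g) x = 0"
      using det_eq[OF that] by (simp add: g algebra_simps)
    then show ?thesis using that by simp
  qed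
  then have sub: "UNIV - {l} \<subseteq> {x. poly (char_poly (B + W) - [:- l - 1, 1:] * g) x = 0}"
    by auto
  have "char_poly (B + W) - [:- l - 1, 1:] * g = 0"
  proof (rule ccontr)
    assume "\<not> ?thesis"
    then have "finite {x. poly (char_poly (B + W) - [:- l - 1, 1:] * g) x = 0}"
      by (rule poly_roots_finite)
    then have "finite (UNIV - {l})"
      using sub finite_subset by blast
    then show False by (simp add: infinite_UNIV_char_0)
  qed
  then have "char_poly (B + W) = [:- l - 1, 1:] * g" by simp
  then show ?thesis using gl by (simp add: algebra_simps)
qed

text \<open>By deflation K = l - (B + W) is invertible, and K p = -p. The left eigenvector is a
  multiple of the first row of the inverse \<open>Z\<close>. For an eigenvector \<open>x\<close>, K
  x is a multiple of \<open>p\<close>, and so is \<open>x\<close> by applying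
  \<open>Z\<close>.\<close>

lemma simple_eigenvalue_left_eigenvector:
  fixes B :: "real mat"
  assumes n: "0 < n" and B: "B \<in> carrier_mat n n" and p: "p \<in> carrier_vec n" and p0: "p $ 0 \<noteq> 0"
    and ev: "B *\<^sub>v p = l \<cdot>\<^sub>v p" and ord: "Polynomial.order l (char_poly B) = 1"
  obtains q where "q \<in> carrier_vec n" "scalar_prod q p = 1"
    "\<And>x. x \<in> carrier_vec n \<Longrightarrow> scalar_prod q (B *\<^sub>v x) = l * (scalar_prod q x)"
    "\<And>x. \<lbrakk>x \<in> carrier_vec n; B *\<^sub>v x = l \<cdot>\<^sub>v x\<rbrakk> \<Longrightarrow> x = (x $ 0 / p $ 0) \<cdot>\<^sub>v p"
proof -
  define W where "W = mat n n (\<lambda>(i, j). if j = 0 then p $ i / p $ 0 else 0)"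
  let ?K = "l \<cdot>\<^sub>m 1\<^sub>m n - (B + W)"
  have W: "W \<in> carrier_mat n n" by (simp add: W_def)
  have K: "?K \<in> carrier_mat n n" using B W by auto
  obtain Z where Z: "Z \<in> carrier_mat n n" and ZK: "Z * ?K = 1\<^sub>m n"
    using char_matrix_inverse[of "B + W" n l] simple_root_deflation[OF assms(1-6)] B W
    by (metis W_def add_carrier_mat)
  have Wx: "W *\<^sub>v x = (x $ 0 / p $ 0) \<cdot>\<^sub>v p" if "x \<in> carrier_vec n" for x
  proof (rule eq_vecI)
    fix i assume i: "i < dim_vec ((x $ 0 / p $ 0) \<cdot>\<^sub>v p)"
    have "(\<Sum>j<n. (if j = 0 then p $ i / p $ 0 else 0) * x $ j) = (\<Sum>j<n. if 0 = j then p $ i / p $ 0 * x $ j else 0)"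
      by (intro sum.cong) auto
    also have "\<dots> = p $ i / p $ 0 * x $ 0" using n by simp
    finally show "(W *\<^sub>v x) $ i = ((x $ 0 / p $ 0) \<cdot>\<^sub>v p) $ i"
      using i p that by (simp add: W_def scalar_prod_def atLeast0LessThan)
  qed (use p W in auto)
  have Kx: "?K *\<^sub>v x = l \<cdot>\<^sub>v x - B *\<^sub>v x - (x $ 0 / p $ 0) \<cdot>\<^sub>v p" if x: "x \<in> carrier_vec n" for x
  proof -
    have "?K *\<^sub>v x = (l \<cdot>\<^sub>m 1\<^sub>m n) *\<^sub>v x - (B *\<^sub>v x + W *\<^sub>v x)"
      using B W x by (simp add: minus_mult_distrib_mat_vec[of _ n n] add_mult_distrib_mat_vec[of _ n n])
    moreover have "(l \<cdot>\<^sub>m 1\<^sub>m n) *\<^sub>v x = l \<cdot>\<^sub>v x"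
      using x by (intro eq_vecI) (auto simp: row_smult)
    ultimately show ?thesis
      using B p x W Wx[OF x] by (intro eq_vecI) auto
  qed
  have ZKx: "Z *\<^sub>v (?K *\<^sub>v x) = x" if "x \<in> carrier_vec n" for x
    using that Z K ZK by (metis assoc_mult_mat_vec one_mult_mat_vec)
  have Kp: "?K *\<^sub>v p = (- 1) \<cdot>\<^sub>v p"
    unfolding Kx[OF p] ev using p p0 by (intro eq_vecI) auto
  have Zp: "Z *\<^sub>v p = (- 1) \<cdot>\<^sub>v p"
  proof -
    have "(- 1) \<cdot>\<^sub>v (Z *\<^sub>v p) = p"
      using ZKx[OF p] Z p unfolding Kp by (simp add: mult_mat_vec)
    then have "(- 1) \<cdot>\<^sub>v ((- 1) \<cdot>\<^sub>v (Z *\<^sub>v p)) = (- 1) \<cdot>\<^sub>v p" by simp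
    then show ?thesis by (simp add: smult_smult_assoc)
  qed
  \<comment> \<open>As \<open>Z\<close> sends \<open>p\<close> to its negative, the factor makes the
    product of \<open>q\<close> and \<open>p\<close> equal to 1. Then the product of
    \<open>q\<close> with K x is -x_0/p_0, which the summand -W x contributes alone, so
    \<open>q\<close> annihilates l x - B x.\<close>
  define q where "q = (- 1 / p $ 0) \<cdot>\<^sub>v row Z 0"
  have q: "q \<in> carrier_vec n" using Z by (auto simp: q_def)
  have qy: "scalar_prod q y = - ((Z *\<^sub>v y) $ 0) / p $ 0" if "y \<in> carrier_vec n" for y
    using that Z n by (simp add: q_def)
  show ?thesis
  proof (rule that[OF q])
    show qp: "scalar_prod q p = 1"
      using p0 p n by (simp add: qy[OF p] Zp)
    show "scalar_prod q (B *\<^sub>v x) = l * (scalar_prod q x)" if x: "x \<in> carrier_vec n" for x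
    proof -
      have Bx: "B *\<^sub>v x \<in> carrier_vec n" using B x by auto
      have "scalar_prod q (?K *\<^sub>v x) = - (x $ 0) / p $ 0"
        using qy[of "?K *\<^sub>v x"] K x ZKx[OF x] by auto
      moreover have "scalar_prod q (?K *\<^sub>v x) = l * (scalar_prod q x) - scalar_prod q (B *\<^sub>v x) - x $ 0 / p $ 0 * (scalar_prod q p)"
        unfolding Kx[OF x] using q x p Bx
        by (simp add: scalar_prod_minus_distrib[of _ n])
      ultimately show ?thesis using qp by simp
    qed
    show "x = (x $ 0 / p $ 0) \<cdot>\<^sub>v p" if x: "x \<in> carrier_vec n" and eq: "B *\<^sub>v x = l \<cdot>\<^sub>v x" for x
    proof -
      have "?K *\<^sub>v x = (- (x $ 0 / p $ 0)) \<cdot>\<^sub>v p"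
        unfolding Kx[OF x] eq using x p by (intro eq_vecI) auto
      then have "x = (- (x $ 0 / p $ 0)) \<cdot>\<^sub>v (Z *\<^sub>v p)"
        using ZKx[OF x] Z p by (metis mult_mat_vec)
      then show ?thesis unfolding Zp by (simp add: smult_smult_assoc)
    qed
  qed
qed

subsection \<open>Eigenvalue pencils on the sphere\<close>

definition mat_app :: "nat \<Rightarrow> real mat \<Rightarrow> (nat \<Rightarrow> real) \<Rightarrow> nat \<Rightarrow> real" where
  "mat_app n A x i = (\<Sum>j<n. A $$ (i, j) * x j)"

definition pencil :: "((nat \<Rightarrow> real) \<Rightarrow> nat \<Rightarrow> real) \<Rightarrow> ((nat \<Rightarrow> real) \<Rightarrow> real) \<Rightarrow> (nat \<Rightarrow> real) \<Rightarrow> nat \<Rightarrow> real" where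
  "pencil g \<mu> x i = \<mu> x * x i - g x i"

text \<open>Here \<open>g\<close> need not be linear. For the map x -> A|x|, an aligned trio
  \<open>(m, S, v)\<close> is encoded by the unit vector x = S v, since S A v = m v means A|x| = m
  x.\<close>

definition eigendirection :: "nat \<Rightarrow> ((nat \<Rightarrow> real) \<Rightarrow> nat \<Rightarrow> real) \<Rightarrow> real \<Rightarrow> (nat \<Rightarrow> real) \<Rightarrow> bool" where
  "eigendirection n g m x \<longleftrightarrow> x \<in> topspace (nsphere (n - 1)) \<and> (\<forall>i<n. g x i = m * x i)"

definition coordinatewise_continuous :: "nat \<Rightarrow> ((nat \<Rightarrow> real) \<Rightarrow> nat \<Rightarrow> real) \<Rightarrow> bool" where
  "coordinatewise_continuous n g \<longleftrightarrow>
     (\<forall>i<n. continuous_map (nsphere (n - 1)) euclideanreal (\<lambda>x. g x i))"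

lemma mat_app_vec:
  assumes "A \<in> carrier_mat n n" "i < n"
  shows "(A *\<^sub>v Matrix.vec n x) $ i = mat_app n A x i"
  using assms by (simp add: mat_app_def scalar_prod_def atLeast0LessThan)

lemma coordinatewise_continuous_mat_app:
  "coordinatewise_continuous n (mat_app n A)"
  "coordinatewise_continuous n (\<lambda>x. mat_app n A (\<lambda>j. \<bar>x j\<bar>))"
  unfolding coordinatewise_continuous_def mat_app_def
  by (auto intro!: continuous_map_sum continuous_map_real_mult continuous_map_real_abs
      continuous_map_nsphere_coordinate)

lemma eigendirection_unique:
  assumes n: "0 < n" and "eigendirection n g m x" "eigendirection n g m' x"
  shows "m = m'"
  using assms nonzero_on_nsphere[OF n, of x] by (auto simp: eigendirection_def)

lemma nonvanishing_pencil:
  assumes n: "0 < n" and g: "coordinatewise_continuous n g"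
    and \<mu>: "continuous_map (nsphere (n - 1)) euclideanreal \<mu>"
    and nz: "\<And>x m. eigendirection n g m x \<Longrightarrow> \<mu> x \<noteq> m"
  shows "nonvanishing_field n (pencil g \<mu>)"
  unfolding nonvanishing_field_def
proof (intro conjI n allI impI ballI)
  show "continuous_map (nsphere (n - 1)) euclideanreal (\<lambda>x. pencil g \<mu> x i)" if "i < n" for i
    unfolding pencil_def using that g unfolding coordinatewise_continuous_def
    by (intro continuous_map_diff continuous_map_real_mult \<mu> continuous_map_nsphere_coordinate) auto
  show "\<exists>i<n. pencil g \<mu> x i \<noteq> 0" if "x \<in> topspace (nsphere (n - 1))" for x
    using nz[of "\<mu> x" x] that by (metis eigendirection_def pencil_def eq_iff_diff_eq_0)
qed

text \<open>A convex combination of two pencils is the pencil of the combined multiplier. A zero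
  would make this multiplier an eigenvalue at \<open>x\<close>, but it lies between
  \<open>\<mu> x\<close> and \<open>\<nu> x\<close>, which are strictly on one side of every such
  eigenvalue.\<close>

lemma field_degree_pencil_homotopic:
  assumes n: "0 < n" and g: "coordinatewise_continuous n g"
    and \<mu>: "continuous_map (nsphere (n - 1)) euclideanreal \<mu>"
    and \<nu>: "continuous_map (nsphere (n - 1)) euclideanreal \<nu>"
    and side: "\<And>x m. eigendirection n g m x \<Longrightarrow> \<mu> x < m \<and> \<nu> x < m \<or> m < \<mu> x \<and> m < \<nu> x"
  shows "field_degree n (pencil g \<mu>) = field_degree n (pencil g \<nu>)"
proof (rule field_degree_homotopic)
  show "nonvanishing_field n (pencil g \<mu>)" "nonvanishing_field n (pencil g \<nu>)"
    using side by (auto intro!: nonvanishing_pencil[OF n g] \<mu> \<nu>)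
  fix t :: real and x
  assume t: "0 \<le> t" "t \<le> 1" and x: "x \<in> topspace (nsphere (n - 1))"
  show "\<exists>i<n. (1 - t) * pencil g \<mu> x i + t * pencil g \<nu> x i \<noteq> 0"
  proof (rule ccontr)
    assume "\<not> ?thesis"
    then have "eigendirection n g ((1 - t) * \<mu> x + t * \<nu> x) x"
      using x by (auto simp: eigendirection_def pencil_def algebra_simps)
    from side[OF this] show False
    proof
      assume *: "\<mu> x < (1 - t) * \<mu> x + t * \<nu> x \<and> \<nu> x < (1 - t) * \<mu> x + t * \<nu> x"
      have "(1 - t) * \<mu> x + t * \<nu> x \<le> max (\<mu> x) (\<nu> x)"
        using t by (intro convex_bound_le) auto
      with * show False by auto
    next
      assume *: "(1 - t) * \<mu> x + t * \<nu> x < \<mu> x \<and> (1 - t) * \<mu> x + t * \<nu> x < \<nu> x"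
      have "(1 - t) * (- \<mu> x) + t * (- \<nu> x) \<le> max (- \<mu> x) (- \<nu> x)"
        using t by (intro convex_bound_le) auto
      with * show False by auto
    qed
  qed
qed

lemma nsphere_abs_le_1:
  assumes n: "0 < n" and x: "x \<in> topspace (nsphere (n - 1))"
  shows "\<bar>x i\<bar> \<le> 1"
proof (cases "i < n")
  case True
  then have "(x i)\<^sup>2 \<le> (\<Sum>i<n. (x i)\<^sup>2)"
    by (intro member_le_sum) auto
  also have "\<dots> = 1" using x unfolding topspace_nsphere_less[OF n] by simp
  finally show ?thesis by (simp add: abs_square_le_1)
next
  case False
  then show ?thesis using x unfolding topspace_nsphere_less[OF n] by simp
qed

lemma nsphere_collinear:
  assumes n: "0 < n" and x: "x \<in> topspace (nsphere (n - 1))" and z: "z \<in> topspace (nsphere (n - 1))"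
    and c: "\<And>i. i < n \<Longrightarrow> x i = c * z i"
  shows "x = z \<or> x = (\<lambda>i. - z i)"
proof -
  have "(\<Sum>i<n. (x i)\<^sup>2) = c\<^sup>2 * (\<Sum>i<n. (z i)\<^sup>2)"
    using c by (simp add: power_mult_distrib sum_distrib_left)
  then have "c\<^sup>2 = 1" using x z unfolding topspace_nsphere_less[OF n] by simp
  then have "c = 1 \<or> c = -1" by (simp add: power2_eq_1_iff)
  moreover have "x i = c * z i" for i
    using c[of i] x z unfolding topspace_nsphere_less[OF n] by (cases "i < n") auto
  ultimately show ?thesis by auto
qed

section \<open>Linear pencils at a simple eigenvalue\<close>

lemma eigendirection_mat_app:
  assumes B: "B \<in> carrier_mat n n" and x: "eigendirection n (mat_app n B) m x"
  shows "B *\<^sub>v Matrix.vec n x = m \<cdot>\<^sub>v Matrix.vec n x"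
proof (rule eq_vecI)
  fix i assume "i < dim_vec (m \<cdot>\<^sub>v Matrix.vec n x)"
  then show "(B *\<^sub>v Matrix.vec n x) $ i = (m \<cdot>\<^sub>v Matrix.vec n x) $ i"
    using x B by (simp add: mat_app_vec[OF B] eigendirection_def del: index_mult_mat_vec)
qed (use B in auto)

lemma eigendirection_root:
  assumes n: "0 < n" and B: "B \<in> carrier_mat n n" and x: "eigendirection n (mat_app n B) m x"
  shows "poly (char_poly B) m = 0"
proof -
  have "Matrix.vec n x \<noteq> 0\<^sub>v n"
    using nonzero_on_nsphere[OF n, of x] x by (auto simp: eigendirection_def vec_eq_iff)
  then have "eigenvector B (Matrix.vec n x) m"
    using eigendirection_mat_app[OF B x] B by (auto simp: eigenvector_def)
  then show ?thesis
    using eigenvalue_root_char_poly[OF B] by (auto simp: eigenvalue_def)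
qed

text \<open>The degree vanishes when \<open>\<nu>\<close> separates the eigenvalue \<open>l\<close> differently at \<open>z\<close> and \<open>-z\<close>: with a left
  eigenvector \<open>q\<close>, the field for \<open>\<nu> x = l - c (q \<bullet> x)\<close> has inner product \<open>- c (q \<bullet> x)\<^sup>2 \<le> 0\<close> with \<open>q\<close>.\<close>

lemma linear_pencil_toggle:
  fixes B :: "real mat"
  assumes n: "0 < n" and B: "B \<in> carrier_mat n n"
    and z: "eigendirection n (mat_app n B) l z" and z0: "z 0 \<noteq> 0"
    and ord: "Polynomial.order l (char_poly B) = 1" and \<delta>: "0 < \<delta>"
  obtains \<epsilon> where "0 < \<epsilon>" "\<epsilon> < \<delta>"
    "\<And>x m. \<lbrakk>eigendirection n (mat_app n B) m x; \<bar>m - l\<bar> \<le> \<epsilon>\<rbrakk> \<Longrightarrow> m = l \<and> (x = z \<or> x = (\<lambda>i. - z i))"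
    "\<bar>field_degree n (pencil (mat_app n B) (\<lambda>_. l + \<epsilon>))\<bar> = 1"
    "\<And>\<nu>. \<lbrakk>continuous_map (nsphere (n - 1)) euclideanreal \<nu>;
        \<And>x. x \<in> topspace (nsphere (n - 1)) \<Longrightarrow> \<bar>\<nu> x - l\<bar> \<le> \<epsilon>; \<nu> z < l; l < \<nu> (\<lambda>i. - z i)\<rbrakk>
        \<Longrightarrow> field_degree n (pencil (mat_app n B) \<nu>) = 0"
proof -
  let ?S = "nsphere (n - 1)" and ?g = "mat_app n B"
  have zS: "z \<in> topspace ?S" using z by (simp add: eigendirection_def)
  obtain q where q: "q \<in> carrier_vec n" and qz: "scalar_prod q (Matrix.vec n z) = 1"
    and qB: "\<And>x. x \<in> carrier_vec n \<Longrightarrow> scalar_prod q (B *\<^sub>v x) = l * scalar_prod q x"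
    and ker: "\<And>x. \<lbrakk>x \<in> carrier_vec n; B *\<^sub>v x = l \<cdot>\<^sub>v x\<rbrakk> \<Longrightarrow> x = (x $ 0 / Matrix.vec n z $ 0) \<cdot>\<^sub>v Matrix.vec n z"
    using simple_eigenvalue_left_eigenvector[OF n B, of "Matrix.vec n z" l]
      eigendirection_mat_app[OF B z] z0 n ord by auto
  have nz: "char_poly B \<noteq> 0"
    using degree_monic_char_poly[OF B] n by auto
  obtain d where d: "0 < d" "\<And>r. \<lbrakk>poly (char_poly B) r = 0; r \<noteq> l\<rbrakk> \<Longrightarrow> d \<le> dist l r"
    using finite_set_avoid[OF poly_roots_finite[OF nz], of l] by auto
  \<comment> \<open>Staying below \<open>d\<close> leaves \<open>l\<close> as the only eigenvalue
    within \<open>\<epsilon>\<close> of \<open>l\<close>; halving makes both bounds strict.\<close>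
  define \<epsilon> where "\<epsilon> = min d \<delta> / 2"
  have \<epsilon>: "0 < \<epsilon>" "\<epsilon> < \<delta>" "\<epsilon> < d" using d(1) \<delta> by (auto simp: \<epsilon>_def)
  have iso: "m = l \<and> (x = z \<or> x = (\<lambda>i. - z i))"
    if x: "eigendirection n ?g m x" and m: "\<bar>m - l\<bar> \<le> \<epsilon>" for x m
  proof -
    have ml: "m = l"
      using d(2)[OF eigendirection_root[OF n B x]] m \<epsilon> by (force simp: dist_real_def)
    have "Matrix.vec n x = (Matrix.vec n x $ 0 / Matrix.vec n z $ 0) \<cdot>\<^sub>v Matrix.vec n z"
      using ker eigendirection_mat_app[OF B x] ml by simp
    then have "Matrix.vec n x $ i = ((Matrix.vec n x $ 0 / Matrix.vec n z $ 0) \<cdot>\<^sub>v Matrix.vec n z) $ i" for i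
      by simp
    then have "x i = x 0 / z 0 * z i" if "i < n" for i
      using that n by (metis dim_vec index_smult_vec(1) index_vec)
    then show ?thesis
      using nsphere_collinear[OF n _ zS] x ml unfolding eigendirection_def by blast
  qed
  show ?thesis
  proof (rule that[OF \<epsilon>(1,2)])
    show "m = l \<and> (x = z \<or> x = (\<lambda>i. - z i))"
      if "eigendirection n ?g m x" "\<bar>m - l\<bar> \<le> \<epsilon>" for x m
      using iso that by blast
    have "poly (char_poly B) (l + \<epsilon>) \<noteq> 0"
      using d(2)[of "l + \<epsilon>"] \<epsilon> by (auto simp: dist_real_def)
    then obtain Z where Z: "Z \<in> carrier_mat n n" "Z * ((l + \<epsilon>) \<cdot>\<^sub>m 1\<^sub>m n - B) = 1\<^sub>m n"
      "((l + \<epsilon>) \<cdot>\<^sub>m 1\<^sub>m n - B) * Z = 1\<^sub>m n"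
      using char_matrix_inverse[OF B] by metis
    define K where "K = (l + \<epsilon>) \<cdot>\<^sub>m 1\<^sub>m n - B"
    have K: "K \<in> carrier_mat n n" using B by (auto simp: K_def)
    have entry: "(\<Sum>j<n. C $$ (i, j) * D $$ (j, k)) = (if i = k then 1 else 0)"
      if "C \<in> carrier_mat n n" "D \<in> carrier_mat n n" "C * D = 1\<^sub>m n" "i < n" "k < n" for C D :: "real mat" and i k
    proof -
      have "(C * D) $$ (i, k) = 1\<^sub>m n $$ (i, k)" using that by simp
      then show ?thesis using that(1,2,4,5) by (simp add: scalar_prod_def atLeast0LessThan)
    qed
    have "\<bar>field_degree n (\<lambda>x i. \<Sum>j<n. K $$ (i, j) * x j)\<bar> = 1"
      using Z K by (intro field_degree_linear[OF n, of "\<lambda>i j. Z $$ (i, j)"] entry) (auto simp: K_def)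
    moreover have pen: "(\<Sum>j<n. K $$ (i, j) * x j) = pencil ?g (\<lambda>_. l + \<epsilon>) x i" if "i < n" for x i
    proof -
      have "(\<Sum>j<n. K $$ (i, j) * x j) = (\<Sum>j<n. (if i = j then (l + \<epsilon>) * x j else 0) - B $$ (i, j) * x j)"
        using that B by (intro sum.cong) (auto simp: K_def algebra_simps)
      then show ?thesis
        using that by (simp add: sum_subtractf pencil_def mat_app_def)
    qed
    moreover have "field_degree n (\<lambda>x i. \<Sum>j<n. K $$ (i, j) * x j) = field_degree n (pencil ?g (\<lambda>_. l + \<epsilon>))"
      by (intro field_degree_cong pen)
    ultimately show "\<bar>field_degree n (pencil ?g (\<lambda>_. l + \<epsilon>))\<bar> = 1"
      by simp
  next
    fix \<nu> assume \<nu>: "continuous_map ?S euclideanreal \<nu>"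
      and range: "\<And>x. x \<in> topspace ?S \<Longrightarrow> \<bar>\<nu> x - l\<bar> \<le> \<epsilon>" and sides: "\<nu> z < l" "l < \<nu> (\<lambda>i. - z i)"
    define Q where "Q x = (\<Sum>i<n. q $ i * x i)" for x
    define C where "C = (\<Sum>i<n. \<bar>q $ i\<bar>) + 1"
    have C: "0 < C" by (auto simp: C_def intro!: add_nonneg_pos sum_nonneg)
    have QC: "\<bar>Q x\<bar> \<le> C" if "x \<in> topspace ?S" for x
    proof -
      have "\<bar>Q x\<bar> \<le> (\<Sum>i<n. \<bar>q $ i * x i\<bar>)" unfolding Q_def by (rule sum_abs)
      also have "\<dots> \<le> (\<Sum>i<n. \<bar>q $ i\<bar>)"
        using nsphere_abs_le_1[OF n that] by (intro sum_mono) (simp add: abs_mult mult_left_le)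
      finally show ?thesis by (simp add: C_def)
    qed
    have Qz: "Q z = 1"
      using qz q by (simp add: Q_def scalar_prod_def atLeast0LessThan)
    have QB: "Q (?g x) = l * Q x" for x
      using qB[of "Matrix.vec n x"] B
      by (simp add: Q_def scalar_prod_def atLeast0LessThan mat_app_def)
    \<comment> \<open>\<open>C\<close> bounds \<open>Q\<close> on the sphere, so
      \<open>\<nu>'\<close> stays within \<open>\<epsilon>\<close> of \<open>l\<close>. As
      \<open>Q z = 1\<close> and \<open>Q\<close> is odd, it is on the same side of \<open>l\<close>
      as \<open>\<nu>\<close> at \<open>z\<close> and at its antipode.\<close>
    define \<nu>' where "\<nu>' x = l - \<epsilon> / C * Q x" for x
    have \<nu>': "continuous_map ?S euclideanreal \<nu>'"
      unfolding \<nu>'_def Q_def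
      by (intro continuous_map_diff continuous_map_real_mult continuous_map_sum
          continuous_map_nsphere_coordinate continuous_map_canonical_const) auto
    have range': "\<bar>\<nu>' x - l\<bar> \<le> \<epsilon>" if "x \<in> topspace ?S" for x
      using QC[OF that] C \<epsilon> by (simp add: \<nu>'_def abs_mult divide_simps)
    have sides': "\<nu>' z < l" "l < \<nu>' (\<lambda>i. - z i)"
      using \<epsilon> C Qz by (simp_all add: \<nu>'_def Q_def sum_negf)
    \<comment> \<open>Apart from \<open>z\<close> and its antipode, eigenvalues are more than
      \<open>\<epsilon>\<close> away from \<open>l\<close>, out of reach of both
      multipliers.\<close>
    have "field_degree n (pencil ?g \<nu>) = field_degree n (pencil ?g \<nu>')"
    proof (rule field_degree_pencil_homotopic[OF n coordinatewise_continuous_mat_app(1) \<nu> \<nu>'])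
      fix x m assume x: "eigendirection n ?g m x"
      then have "x \<in> topspace ?S" by (simp add: eigendirection_def)
      from range[OF this] range'[OF this]
      show "\<nu> x < m \<and> \<nu>' x < m \<or> m < \<nu> x \<and> m < \<nu>' x"
        using iso[OF x] sides sides' by (cases "\<bar>m - l\<bar> \<le> \<epsilon>") auto
    qed
    also have "\<dots> = 0"
    proof (rule field_degree_half_space)
      show "nonvanishing_field n (pencil ?g \<nu>')"
      proof (rule nonvanishing_pencil[OF n coordinatewise_continuous_mat_app(1) \<nu>'])
        fix x m assume x: "eigendirection n ?g m x"
        then have "x \<in> topspace ?S" by (simp add: eigendirection_def)
        from range'[OF this] show "\<nu>' x \<noteq> m"
          using iso[OF x] sides' by auto
      qed
      show "\<exists>i<n. q $ i \<noteq> 0"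
      proof (rule ccontr)
        assume "\<not> ?thesis"
        then have "Q z = 0" by (simp add: Q_def)
        then show False using Qz by simp
      qed
      fix x
      have "(\<Sum>i<n. q $ i * pencil ?g \<nu>' x i) = \<nu>' x * Q x - Q (?g x)"
        by (simp add: pencil_def Q_def algebra_simps sum_subtractf sum_distrib_left)
      also have "\<dots> = - (\<epsilon> / C * (Q x)\<^sup>2)"
        by (simp add: QB \<nu>'_def power2_eq_square algebra_simps)
      finally show "(\<Sum>i<n. q $ i * pencil ?g \<nu>' x i) \<le> 0"
        using \<epsilon> C by simp
    qed
    finally show "field_degree n (pencil ?g \<nu>) = 0" .
  qed
qed

section \<open>The map x -> A|x| near an aligned direction\<close>

definition abs_app :: "nat \<Rightarrow> real mat \<Rightarrow> (nat \<Rightarrow> real) \<Rightarrow> nat \<Rightarrow> real" where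
  "abs_app n A x = mat_app n A (\<lambda>j. \<bar>x j\<bar>)"

lemma coordinatewise_continuous_abs_app: "coordinatewise_continuous n (abs_app n A)"
  using coordinatewise_continuous_mat_app(2) by (simp add: abs_app_def[abs_def])

text \<open>If the signs agree, |x_j| = sgn(z_j) x_j, so the map acts on \<open>x\<close> as the
  matrix A diag(sgn z).\<close>

lemma abs_app_same_signs:
  assumes "\<And>j. j < n \<Longrightarrow> sgn (x j) = sgn (z j)" "i < n"
  shows "abs_app n A x i = mat_app n (mat n n (\<lambda>(i, j). A $$ (i, j) * sgn (z j))) x i"
  unfolding abs_app_def mat_app_def using assms
  by (intro sum.cong) (simp_all add: abs_sgn flip: assms(1))

text \<open>Near \<open>z\<close> the map \<open>x \<mapsto> A|x|\<close> is the linear map \<open>B\<close>. By the exchange lemma, moving \<open>\<mu>\<close> across \<open>l\<close>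
  near \<open>z\<close> only changes the degree as it does for the linear field, which is from \<open>\<plusminus>1\<close> to \<open>0\<close>.\<close>

lemma aligned_toggle:
  fixes A :: "real mat" and n :: nat
  defines "g \<equiv> abs_app n A"
  assumes n: "0 < n"
    and fin: "finite {x. \<exists>m>0. eigendirection n g m x}"
    and z: "eigendirection n g l z" and l: "0 < l" and z0: "\<And>i. i < n \<Longrightarrow> z i \<noteq> 0"
    and ord: "Polynomial.order l (char_poly (mat n n (\<lambda>(i, j). A $$ (i, j) * sgn (z j)))) = 1"
    and \<mu>: "continuous_map (nsphere (n - 1)) euclideanreal \<mu>"
    and pos: "\<And>x. x \<in> topspace (nsphere (n - 1)) \<Longrightarrow> 0 < \<mu> x"
    and ne: "\<And>x m. eigendirection n g m x \<Longrightarrow> \<mu> x \<noteq> m" and \<mu>z: "\<mu> z < l"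
  obtains \<mu>' where "continuous_map (nsphere (n - 1)) euclideanreal \<mu>'"
    "\<And>x. x \<in> topspace (nsphere (n - 1)) \<Longrightarrow> 0 < \<mu>' x" "l < \<mu>' z"
    "\<And>x m. \<lbrakk>eigendirection n g m x; 0 < m; x \<noteq> z\<rbrakk> \<Longrightarrow> \<mu>' x = \<mu> x"
    "odd (field_degree n (pencil g \<mu>) - field_degree n (pencil g \<mu>'))"
proof -
  let ?S = "nsphere (n - 1)"
  define B where "B = mat n n (\<lambda>(i, j). A $$ (i, j) * sgn (z j))"
  let ?h = "mat_app n B"
  have B: "B \<in> carrier_mat n n" by (simp add: B_def)
  have zS: "z \<in> topspace ?S" using z by (simp add: eigendirection_def)
  have gc: "coordinatewise_continuous n g"
    unfolding g_def by (rule coordinatewise_continuous_abs_app)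
  note hc = coordinatewise_continuous_mat_app(1)[of n B]
  have zB: "eigendirection n ?h l z"
    using z abs_app_same_signs[of n z z _ A] by (simp add: eigendirection_def g_def B_def)
  \<comment> \<open>The bound \<open>\<epsilon> < l\<close> keeps multipliers within
    \<open>\<epsilon>\<close> of \<open>l\<close> positive.\<close>
  obtain \<epsilon> where \<epsilon>: "0 < \<epsilon>" "\<epsilon> < l"
    and iso: "\<And>x m. \<lbrakk>eigendirection n ?h m x; \<bar>m - l\<bar> \<le> \<epsilon>\<rbrakk> \<Longrightarrow> m = l \<and> (x = z \<or> x = (\<lambda>i. - z i))"
    and deg1: "\<bar>field_degree n (pencil ?h (\<lambda>_. l + \<epsilon>))\<bar> = 1"
    and deg0: "\<And>\<nu>. \<lbrakk>continuous_map ?S euclideanreal \<nu>;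
        \<And>x. x \<in> topspace ?S \<Longrightarrow> \<bar>\<nu> x - l\<bar> \<le> \<epsilon>; \<nu> z < l; l < \<nu> (\<lambda>i. - z i)\<rbrakk>
        \<Longrightarrow> field_degree n (pencil ?h \<nu>) = 0"
  proof (rule linear_pencil_toggle[OF n B zB z0[OF n] ord[folded B_def] l], goal_cases)
    case (1 \<epsilon>)
    show ?case by (rule that) (fact 1)+
  qed
  define D where "D x = L2_set (\<lambda>i. x i - z i) {..<n}" for x
  have Dcont: "continuous_map ?S euclideanreal D"
    unfolding D_def L2_set_def
    by (intro continuous_map_sqrt continuous_map_sum continuous_map_real_pow continuous_map_diff
        continuous_map_nsphere_coordinate continuous_map_canonical_const) auto
  have Dcoord: "\<bar>x i - z i\<bar> \<le> D x" if "i < n" for x i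
  proof -
    have "\<bar>x i - z i\<bar> \<le> L2_set (\<lambda>i. \<bar>x i - z i\<bar>) {..<n}"
      using that by (intro member_le_L2_set) auto
    then show ?thesis by (simp add: D_def L2_set_def)
  qed
  have Dpos: "0 < D x" if "x \<in> topspace ?S" "x \<noteq> z" for x
  proof -
    have "\<exists>i<n. x i \<noteq> z i"
    proof (rule ccontr)
      assume "\<not> ?thesis"
      then have "x i = z i" for i
        using that zS unfolding topspace_nsphere_less[OF n] by (cases "i < n") auto
      then show False using that by auto
    qed
    then show ?thesis unfolding D_def by (intro L2_set_pos) auto
  qed
  \<comment> \<open>Below the minimum of \<open>F\<close> no coordinate can change sign and no other
    aligned direction is met; the element 1 keeps \<open>F\<close> nonempty.\<close>
  define F where "F = insert 1 ((\<lambda>i. \<bar>z i\<bar>) ` {..<n} \<union> D ` ({x. \<exists>m>0. eigendirection n g m x} - {z}))"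
  have "finite F" using fin by (simp add: F_def)
  define \<rho> where "\<rho> = Min F"
  have "0 < y" if "y \<in> F" for y
  proof -
    from that consider "y = 1" | i where "i < n" "y = \<bar>z i\<bar>"
      | x m where "eigendirection n g m x" "x \<noteq> z" "y = D x"
      unfolding F_def by blast
    then show ?thesis
      using z0 Dpos by cases (simp_all add: eigendirection_def)
  qed
  moreover have "F \<noteq> {}" by (simp add: F_def)
  ultimately have \<rho>: "0 < \<rho>"
    using Min_in[OF \<open>finite F\<close>] unfolding \<rho>_def by blast
  have \<rho>_le: "\<rho> \<le> y" if "y \<in> F" for y
    using that \<open>finite F\<close> by (simp add: \<rho>_def)
  \<comment> \<open>The bump \<open>\<beta>\<close> lives on \<open>d \<le> 1\<close> and the cutoff \<open>\<gamma>\<close> is \<open>1\<close> on \<open>d \<le> 2\<close>; on \<open>d < 3\<close> signs agree with \<open>z\<close>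
    and \<open>z\<close> is the only aligned direction.\<close>
  define d where "d x = 3 * D x / \<rho>" for x
  have d: "continuous_map ?S euclideanreal d"
    unfolding d_def using \<rho>
    by (intro continuous_map_real_divide continuous_map_real_mult Dcont continuous_map_canonical_const) auto
  have dz: "d z = 0" by (simp add: d_def D_def L2_set_def)
  have d_other: "3 \<le> d x" if "eigendirection n g m x" "0 < m" "x \<noteq> z" for x m
  proof -
    have "\<rho> \<le> D x" using that by (intro \<rho>_le) (auto simp: F_def)
    then show ?thesis using \<rho> by (simp add: d_def divide_simps)
  qed
  have same_signs: "sgn (x i) = sgn (z i)" if "d x < 3" "i < n" for x i
  proof -
    have "D x < \<rho>" using that(1) \<rho> by (simp add: d_def divide_simps)
    moreover have "\<rho> \<le> \<bar>z i\<bar>" using that(2) by (intro \<rho>_le) (auto simp: F_def)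
    ultimately have "\<bar>x i - z i\<bar> < \<bar>z i\<bar>" using Dcoord[OF that(2), of x] by simp
    then show ?thesis by (auto simp: sgn_if abs_if split: if_splits)
  qed
  \<comment> \<open>The antipode is an eigendirection of the linear map too, so the bump must not
    reach it. Its sign at coordinate 0 is wrong, which puts it far from \<open>z\<close>.\<close>
  have d_antipode: "3 \<le> d (\<lambda>i. - z i)"
    using same_signs[of "\<lambda>i. - z i" 0] z0[OF n] n by (force simp: sgn_if split: if_splits)
  define \<beta> where "\<beta> x = max 0 (1 - d x)" for x
  define \<gamma> where "\<gamma> x = max 0 (min 1 (3 - d x))" for x
  have \<beta>\<gamma>: "continuous_map ?S euclideanreal \<beta>" "continuous_map ?S euclideanreal \<gamma>"
    unfolding \<beta>_def \<gamma>_def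
    by (intro continuous_map_real_max continuous_map_real_min continuous_map_diff d
        continuous_map_canonical_const)+
  \<comment> \<open>\<open>\<mu>1\<close> is the new multiplier: \<open>l + \<epsilon>\<close> near
    \<open>z\<close> and \<open>\<mu>\<close> where \<open>d\<close> is at least 3.
    \<open>\<mu>2\<close> dips from it to \<open>l - \<epsilon>\<close> at \<open>z\<close>, back to
    the side of \<open>\<mu>\<close>; \<open>\<nu>2\<close> is the same dip for the linear
    field.\<close>
  define \<mu>1 where "\<mu>1 x = \<gamma> x * (l + \<epsilon>) + (1 - \<gamma> x) * \<mu> x" for x
  define \<mu>2 where "\<mu>2 x = \<mu>1 x - 2 * \<epsilon> * \<beta> x" for x
  define \<nu>2 where "\<nu>2 x = l + \<epsilon> - 2 * \<epsilon> * \<beta> x" for x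
  have d_nonneg: "0 \<le> d x" for x
    using \<rho> by (simp add: d_def D_def L2_set_nonneg)
  have \<gamma>: "0 \<le> \<gamma> x" "\<gamma> x \<le> 1" for x by (auto simp: \<gamma>_def)
  have \<beta>: "0 \<le> \<beta> x" "\<beta> x \<le> 1" for x using d_nonneg[of x] by (auto simp: \<beta>_def)
  have \<mu>1: "continuous_map ?S euclideanreal \<mu>1"
    unfolding \<mu>1_def
    by (intro continuous_map_add continuous_map_real_mult continuous_map_diff \<beta>\<gamma> \<mu> continuous_map_canonical_const)
  have \<mu>2: "continuous_map ?S euclideanreal \<mu>2"
    unfolding \<mu>2_def
    by (intro continuous_map_real_mult continuous_map_diff \<beta>\<gamma> \<mu>1 continuous_map_canonical_const)
  have \<nu>2: "continuous_map ?S euclideanreal \<nu>2"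
    unfolding \<nu>2_def
    by (intro continuous_map_real_mult continuous_map_diff \<beta>\<gamma> continuous_map_canonical_const)
  have \<mu>1pos: "0 < \<mu>1 x" if "x \<in> topspace ?S" for x
  proof -
    have "0 < \<mu> x" by (rule pos[OF that])
    then show ?thesis
      using \<gamma>[of x] l \<epsilon> by (cases "\<gamma> x = 0") (auto simp: \<mu>1_def intro!: add_pos_nonneg mult_pos_pos)
  qed
  have near: "\<mu>1 x = l + \<epsilon>" "\<mu>2 x = \<nu>2 x" if "d x < 2" for x
    using that by (simp_all add: \<mu>1_def \<mu>2_def \<nu>2_def \<gamma>_def)
  have far: "\<mu>2 x = \<mu>1 x" "\<nu>2 x = l + \<epsilon>" if "1 < d x" for x
    using that by (simp_all add: \<mu>2_def \<nu>2_def \<beta>_def)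
  have \<nu>2_range: "\<bar>\<nu>2 x - l\<bar> \<le> \<epsilon>" for x
  proof -
    have "\<epsilon> * \<beta> x \<le> \<epsilon>" "0 \<le> \<epsilon> * \<beta> x"
      using \<beta>[of x] \<epsilon> by (simp_all add: mult_left_le)
    then show ?thesis unfolding \<nu>2_def by linarith
  qed
  have \<mu>2pos: "0 < \<mu>2 x" if "x \<in> topspace ?S" for x
    using near(2)[of x] far(1)[of x] \<mu>1pos[OF that] \<nu>2_range[of x] \<epsilon> by (cases "d x < 2") auto
  have at_z: "\<mu>1 z = l + \<epsilon>" "\<mu>2 z = l - \<epsilon>" "\<nu>2 z = l - \<epsilon>"
    using near[of z] dz by (simp_all add: \<nu>2_def \<beta>_def)
  have at_other: "\<mu>1 x = \<mu> x" "\<mu>2 x = \<mu> x" if "eigendirection n g m x" "0 < m" "x \<noteq> z" for x m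
    using d_other[OF that] far(1)[of x] by (simp_all add: \<mu>1_def \<gamma>_def)
  have at_antipode: "\<nu>2 (\<lambda>i. - z i) = l + \<epsilon>"
    using far(2) d_antipode by simp
  \<comment> \<open>At \<open>z\<close> both are below \<open>l\<close>, at the other aligned
    directions they coincide, and positivity settles the case \<open>m \<le> 0\<close>.\<close>
  have side2: "\<mu> x < m \<and> \<mu>2 x < m \<or> m < \<mu> x \<and> m < \<mu>2 x" if x: "eigendirection n g m x" for x m
  proof -
    have xS: "x \<in> topspace ?S" using x by (simp add: eigendirection_def)
    show ?thesis
    proof (cases "0 < m")
      case m: True
      show ?thesis
      proof (cases "x = z")
        case True
        then have "m = l" using eigendirection_unique[OF n] x z by blast
        then show ?thesis using True at_z \<mu>z \<epsilon> by simp
      next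
        case False
        then show ?thesis using at_other[OF x m] ne[OF x] by auto
      qed
    next
      case False
      then show ?thesis using pos[OF xS] \<mu>2pos[OF xS] by auto
    qed
  qed
  have side1: "\<mu>1 x \<noteq> m" if x: "eigendirection n g m x" for x m
  proof -
    have xS: "x \<in> topspace ?S" using x by (simp add: eigendirection_def)
    show ?thesis
    proof (cases "x = z")
      case True
      then have "m = l" using eigendirection_unique[OF n] x z by blast
      then show ?thesis using True at_z \<epsilon> by simp
    next
      case False
      then show ?thesis
        using at_other[OF x] ne[OF x] \<mu>1pos[OF xS] by (cases "0 < m") auto
    qed
  qed
  have nv: "nonvanishing_field n (pencil g \<mu>1)" "nonvanishing_field n (pencil g \<mu>2)"
    using side1 side2 by (force intro!: nonvanishing_pencil[OF n gc] \<mu>1 \<mu>2)+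
  have nvh: "nonvanishing_field n (pencil ?h (\<lambda>_. l + \<epsilon>))" "nonvanishing_field n (pencil ?h \<nu>2)"
  proof -
    show "nonvanishing_field n (pencil ?h (\<lambda>_. l + \<epsilon>))"
      using iso[of "l + \<epsilon>"] \<epsilon> by (intro nonvanishing_pencil[OF n hc]) auto
    show "nonvanishing_field n (pencil ?h \<nu>2)"
    proof (rule nonvanishing_pencil[OF n hc \<nu>2])
      fix x m assume "eigendirection n ?h m x"
      then show "\<nu>2 x \<noteq> m"
        using iso[of m x] \<nu>2_range[of x] at_z at_antipode \<epsilon> by auto
    qed
  qed
  have gh: "pencil g \<sigma> x i = pencil ?h \<tau> x i"
    if "d x < 2" "\<sigma> x = \<tau> x" "i < n" for \<sigma> \<tau> :: "(nat \<Rightarrow> real) \<Rightarrow> real" and x i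
    using abs_app_same_signs[of n x z i A] same_signs that by (simp add: pencil_def g_def B_def)
  \<comment> \<open>The exchange lemma is applied with \<open>d \<le> 1\<close>, outside of which
    the dips vanish, and \<open>d < 2\<close>, where the nonlinear fields equal the linear
    ones.\<close>
  have "?S closure_of {x. d x \<le> 1} \<subseteq> {x \<in> topspace ?S. d x \<in> {..1}}"
  proof -
    have "?S closure_of (topspace ?S \<inter> {x. d x \<le> 1}) \<subseteq> {x \<in> topspace ?S. d x \<in> {..1}}"
      using closedin_continuous_map_preimage[OF d, of "{..1}"] by (intro closure_of_minimal) auto
    then show ?thesis by (simp flip: closure_of_restrict)
  qed
  also have "\<dots> \<subseteq> {x \<in> topspace ?S. d x \<in> {..<2}}" by auto
  also have "\<dots> \<subseteq> ?S interior_of {x. d x < 2}"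
    using openin_continuous_map_preimage[OF d, of "{..<2}"] by (intro interior_of_maximal) auto
  finally have "field_degree n (pencil g \<mu>1) - field_degree n (pencil g \<mu>2)
      = field_degree n (pencil ?h (\<lambda>_. l + \<epsilon>)) - field_degree n (pencil ?h \<nu>2)"
    unfolding field_degree_def
  proof (rule Brouwer_degree2_exchange[rotated -1])
    fix x
    show "normalized n (pencil g \<mu>1 x) = normalized n (pencil ?h (\<lambda>_. l + \<epsilon>) x)
        \<and> normalized n (pencil g \<mu>2 x) = normalized n (pencil ?h \<nu>2 x)" if "x \<in> {x. d x < 2}"
      using that near by (auto intro!: normalized_cong gh)
    show "normalized n (pencil g \<mu>1 x) = normalized n (pencil g \<mu>2 x)
        \<and> normalized n (pencil ?h (\<lambda>_. l + \<epsilon>) x) = normalized n (pencil ?h \<nu>2 x)" if "x \<notin> {x. d x \<le> 1}"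
      using that far[of x] by (auto simp: pencil_def intro!: normalized_cong)
  qed (intro continuous_map_field nv nvh)+
  moreover have "field_degree n (pencil ?h \<nu>2) = 0"
    using \<nu>2_range at_z at_antipode \<epsilon> by (intro deg0 \<nu>2) auto
  moreover have "field_degree n (pencil g \<mu>) = field_degree n (pencil g \<mu>2)"
    by (rule field_degree_pencil_homotopic[OF n gc \<mu> \<mu>2 side2])
  ultimately have "field_degree n (pencil g \<mu>) - field_degree n (pencil g \<mu>1)
      = - field_degree n (pencil ?h (\<lambda>_. l + \<epsilon>))" by simp
  then have "odd (field_degree n (pencil g \<mu>) - field_degree n (pencil g \<mu>1))"
    using deg1 by (auto simp: abs_if split: if_splits)
  then show ?thesis
    using that[OF \<mu>1 \<mu>1pos] at_z at_other \<epsilon> by force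
qed

section \<open>Multipliers above or below all eigenvalues, and the parity of the degree\<close>

lemma field_degree_pencil_above:
  assumes n: "0 < n" and g: "coordinatewise_continuous n g"
    and \<mu>: "continuous_map (nsphere (n - 1)) euclideanreal \<mu>"
    and above: "\<And>x m. eigendirection n g m x \<Longrightarrow> m < \<mu> x"
  shows "field_degree n (pencil g \<mu>) = 1"
proof -
  have "field_degree n (pencil g \<mu>) = field_degree n (\<lambda>x. x)"
  proof (rule field_degree_homotopic)
    show "nonvanishing_field n (pencil g \<mu>)"
      using above by (intro nonvanishing_pencil[OF n g \<mu>]) fastforce
    show "nonvanishing_field n (\<lambda>x. x)"
      using n nonzero_on_nsphere[OF n] continuous_map_nsphere_coordinate
      by (auto simp: nonvanishing_field_def)
    fix t :: real and x
    assume t: "0 \<le> t" "t \<le> 1" and x: "x \<in> topspace (nsphere (n - 1))"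
    show "\<exists>i<n. (1 - t) * pencil g \<mu> x i + t * x i \<noteq> 0"
    proof (rule ccontr)
      assume "\<not> ?thesis"
      then have *: "(1 - t) * pencil g \<mu> x i + t * x i = 0" if "i < n" for i using that by blast
      show False
      proof (cases "t = 1")
        case True
        then show False using * nonzero_on_nsphere[OF n x] by auto
      next
        case False
        \<comment> \<open>The segment to the identity in effect raises the multiplier to
          \<open>\<mu> x + t / (1 - t)\<close>, which is still above every eigenvalue at
          \<open>x\<close>.\<close>
        then have "g x i = (\<mu> x + t / (1 - t)) * x i" if "i < n" for i
          using *[OF that] by (simp add: pencil_def field_simps)
        then have "\<mu> x + t / (1 - t) < \<mu> x"
          using x by (intro above) (simp add: eigendirection_def)
        then show False using t by (simp add: divide_less_0_iff)
      qed
    qed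
  qed
  then show ?thesis using field_degree_id[OF n] by simp
qed

text \<open>Either \<open>q\<^sup>T A = 0\<close> or \<open>q\<^sup>T A = e\<^sub>0\<^sup>T\<close>, according to whether \<open>A\<close> is singular.\<close>

lemma nonneg_functional_on_orthant_image:
  fixes A :: "real mat"
  assumes n: "0 < n" and A: "A \<in> carrier_mat n n"
  obtains q where "q \<in> carrier_vec n" "q \<noteq> 0\<^sub>v n" "\<And>x. 0 \<le> (\<Sum>i<n. q $ i * abs_app n A x i)"
proof -
  have sum: "(\<Sum>i<n. q $ i * abs_app n A x i) = (\<Sum>j<n. (transpose_mat A *\<^sub>v q) $ j * \<bar>x j\<bar>)"
    if q: "q \<in> carrier_vec n" for q x
  proof -
    have "(\<Sum>i<n. q $ i * abs_app n A x i) = (\<Sum>j<n. \<Sum>i<n. q $ i * (A $$ (i, j) * \<bar>x j\<bar>))"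
      unfolding abs_app_def mat_app_def sum_distrib_left by (rule sum.swap)
    also have "\<dots> = (\<Sum>j<n. (transpose_mat A *\<^sub>v q) $ j * \<bar>x j\<bar>)"
      using A q by (intro sum.cong)
        (simp_all add: scalar_prod_def atLeast0LessThan sum_distrib_left mult_ac)
    finally show ?thesis .
  qed
  show ?thesis
  proof (cases "det A = 0")
    case True
    then obtain q where "q \<in> carrier_vec n" "q \<noteq> 0\<^sub>v n" "transpose_mat A *\<^sub>v q = 0\<^sub>v n"
      using det_0_iff_vec_prod_zero[of "transpose_mat A" n] A det_transpose[OF A] by auto
    then show ?thesis using that[of q] sum by simp
  next
    case False
    then obtain Z where Z: "Z \<in> carrier_mat n n" "transpose_mat A * Z = 1\<^sub>m n"
      using det_non_zero_imp_unit[of "transpose_mat A" n "()"] A det_transpose[OF A]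
      by (auto simp: Units_def ring_mat_def)
    define q where "q = Z *\<^sub>v unit_vec n 0"
    have q: "q \<in> carrier_vec n" using Z by (auto simp: q_def)
    have Aq: "transpose_mat A *\<^sub>v q = unit_vec n 0"
      unfolding q_def using Z A
      by (metis assoc_mult_mat_vec one_mult_mat_vec transpose_carrier_mat unit_vec_carrier)
    have "q \<noteq> 0\<^sub>v n"
    proof
      assume "q = 0\<^sub>v n"
      then have "transpose_mat A *\<^sub>v q = 0\<^sub>v n" using A by auto
      then show False using Aq n by (metis index_unit_vec(1) index_zero_vec(1) zero_neq_one)
    qed
    moreover have "0 \<le> (\<Sum>j<n. (transpose_mat A *\<^sub>v q) $ j * \<bar>x j\<bar>)" for x :: "nat \<Rightarrow> real"
      unfolding Aq by (intro sum_nonneg) (simp add: unit_vec_def)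
    ultimately show ?thesis using that[OF q] sum[OF q] by simp
  qed
qed

text \<open>There is no eigenvalue in [0, 1], so the multiplier can be lowered from 1 to 0 without a
  crossing. The remaining field -A|x| lies in a half space, as some nonzero \<open>q\<close> is
  nonnegative on all A|x|.\<close>

lemma field_degree_pencil_below:
  fixes A :: "real mat"
  assumes n: "0 < n" and A: "A \<in> carrier_mat n n"
    and below: "\<And>x m. \<lbrakk>eigendirection n (abs_app n A) m x; 0 \<le> m\<rbrakk> \<Longrightarrow> 1 < m"
  shows "field_degree n (pencil (abs_app n A) (\<lambda>_. 1)) = 0"
proof -
  note gc = coordinatewise_continuous_abs_app[of n A]
  have "field_degree n (pencil (abs_app n A) (\<lambda>_. 1)) = field_degree n (pencil (abs_app n A) (\<lambda>_. 0))"
  proof (rule field_degree_pencil_homotopic[OF n gc])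
    fix x m assume "eigendirection n (abs_app n A) m x"
    then show "1 < m \<and> 0 < m \<or> m < 1 \<and> m < 0"
      using below[of m x] by (cases "0 \<le> m") auto
  qed simp_all
  also have "\<dots> = 0"
  proof -
    obtain q where q: "q \<in> carrier_vec n" "q \<noteq> 0\<^sub>v n"
      and qA: "\<And>x. 0 \<le> (\<Sum>i<n. q $ i * abs_app n A x i)"
      using nonneg_functional_on_orthant_image[OF n A] by blast
    show ?thesis
    proof (rule field_degree_half_space)
      show "nonvanishing_field n (pencil (abs_app n A) (\<lambda>_. 0))"
        using below by (intro nonvanishing_pencil[OF n gc]) fastforce+
      show "\<exists>i<n. q $ i \<noteq> 0"
        using q by (auto simp: vec_eq_iff)
      show "(\<Sum>i<n. q $ i * pencil (abs_app n A) (\<lambda>_. 0) x i) \<le> 0" for x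
        using qA[of x] by (simp add: pencil_def sum_negf)
    qed
  qed
  finally show ?thesis .
qed

text \<open>Induction on the number of aligned directions still above the multiplier: lifting it
  over one of them flips the parity of the degree and lowers the number by 1. Each lift is local, so
  \<open>\<mu>\<close> has to range over nonconstant functions.\<close>

lemma field_degree_pencil_parity:
  fixes A :: "real mat" and n :: nat
  defines "g \<equiv> abs_app n A"
  assumes n: "0 < n"
    and fin: "finite {x. \<exists>m>0. eigendirection n g m x}"
    and nz: "\<And>z l i. \<lbrakk>eigendirection n g l z; 0 < l; i < n\<rbrakk> \<Longrightarrow> z i \<noteq> 0"
    and ord: "\<And>z l. \<lbrakk>eigendirection n g l z; 0 < l\<rbrakk> \<Longrightarrow>
      Polynomial.order l (char_poly (mat n n (\<lambda>(i, j). A $$ (i, j) * sgn (z j)))) = 1"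
    and \<mu>: "continuous_map (nsphere (n - 1)) euclideanreal \<mu>"
    and pos: "\<And>x. x \<in> topspace (nsphere (n - 1)) \<Longrightarrow> 0 < \<mu> x"
    and ne: "\<And>x m. eigendirection n g m x \<Longrightarrow> \<mu> x \<noteq> m"
  shows "even (field_degree n (pencil g \<mu>) - 1 - int (card {x. \<exists>m>0. eigendirection n g m x \<and> \<mu> x < m}))"
  using \<mu> pos ne
proof (induction "card {x. \<exists>m>0. eigendirection n g m x \<and> \<mu> x < m}" arbitrary: \<mu>)
  case 0
  let ?N = "{x. \<exists>m>0. eigendirection n g m x \<and> \<mu> x < m}"
  \<comment> \<open>Infinite sets also have \<open>card\<close> 0, so emptiness requires
    finiteness.\<close>
  have "finite ?N" by (rule finite_subset[OF _ fin]) auto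
  then have N: "?N = {}" using 0(1) by simp
  have "field_degree n (pencil g \<mu>) = 1"
  proof (rule field_degree_pencil_above[OF n _ 0(2)])
    fix x m assume x: "eigendirection n g m x"
    then have "0 < \<mu> x" by (intro 0(3)) (simp add: eigendirection_def)
    then show "m < \<mu> x" using N x 0(4)[OF x] by force
  qed (simp add: g_def coordinatewise_continuous_abs_app)
  then show ?case using 0(1) by simp
next
  case (Suc k)
  define N where "N \<mu> = {x. \<exists>m>0. eigendirection n g m x \<and> \<mu> x < m}" for \<mu>
  have finN: "finite (N \<mu>)" for \<mu> unfolding N_def by (rule finite_subset[OF _ fin]) auto
  have cardN: "Suc k = card (N \<mu>)" using Suc.hyps(2) by (simp add: N_def)
  then obtain z where "z \<in> N \<mu>" by fastforce
  then obtain l where z: "eigendirection n g l z" and l: "0 < l" "\<mu> z < l" by (auto simp: N_def)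
  obtain \<mu>' where \<mu>': "continuous_map (nsphere (n - 1)) euclideanreal \<mu>'"
    "\<And>x. x \<in> topspace (nsphere (n - 1)) \<Longrightarrow> 0 < \<mu>' x" "l < \<mu>' z"
    "\<And>x m. \<lbrakk>eigendirection n g m x; 0 < m; x \<noteq> z\<rbrakk> \<Longrightarrow> \<mu>' x = \<mu> x"
    "odd (field_degree n (pencil g \<mu>) - field_degree n (pencil g \<mu>'))"
    using aligned_toggle[OF n fin[unfolded g_def] z[unfolded g_def] l(1) nz[OF z l(1)]
        ord[OF z l(1)] Suc.prems(1,2) Suc.prems(3)[unfolded g_def] l(2)]
    unfolding g_def by blast
  have ml: "m = l" if "eigendirection n g m z" for m
    using eigendirection_unique[OF n that z] .
  have "N \<mu>' = N \<mu> - {z}"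
    using \<mu>'(3,4) ml unfolding N_def by force
  then have card': "k = card (N \<mu>')"
    using cardN \<open>z \<in> N \<mu>\<close> finN[of \<mu>] by simp
  have "\<mu>' x \<noteq> m" if x: "eigendirection n g m x" for x m
  proof (cases "0 < m \<and> x \<noteq> z")
    case True
    then show ?thesis using \<mu>'(4)[OF x] Suc.prems(3)[OF x] by simp
  next
    case False
    then show ?thesis using \<mu>'(2)[of x] \<mu>'(3) ml x by (force simp: eigendirection_def)
  qed
  then have "even (field_degree n (pencil g \<mu>') - 1 - int (card (N \<mu>')))"
    using Suc.hyps(1)[of \<mu>'] \<mu>'(1,2) card' by (simp add: N_def)
  moreover have "int (card (N \<mu>)) = int (card (N \<mu>')) + 1"
    using card' cardN by simp
  ultimately show ?case
    using \<mu>'(5) unfolding N_def[symmetric] by simp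
qed

subsection \<open>Aligned directions\<close>

text \<open>A zero coordinate is given the sign 1, so that the result is a sign matrix for every
  \<open>x\<close>.\<close>

definition sign_mat :: "nat \<Rightarrow> (nat \<Rightarrow> real) \<Rightarrow> real mat" where
  "sign_mat n x = mat n n (\<lambda>(i, j). if i = j then (if x i < 0 then -1 else 1) else 0)"

definition abs_part :: "nat \<Rightarrow> (nat \<Rightarrow> real) \<Rightarrow> real vec" where
  "abs_part n x = Matrix.vec n (\<lambda>i. \<bar>x i\<bar>)"

lemma diagonal_mat_mult_vec:
  fixes S :: "real mat"
  assumes "S \<in> carrier_mat n n" "diagonal_mat S" "w \<in> carrier_vec n" "i < n"
  shows "(S *\<^sub>v w) $ i = S $$ (i, i) * w $ i"
proof -
  have "(S *\<^sub>v w) $ i = (\<Sum>j<n. S $$ (i, j) * w $ j)"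
    using assms by (simp add: scalar_prod_def atLeast0LessThan)
  also have "\<dots> = (\<Sum>j<n. if i = j then S $$ (i, j) * w $ j else 0)"
    using assms by (intro sum.cong) (auto simp: diagonal_mat_def)
  finally show ?thesis using assms by simp
qed

lemma sign_mat_in: "sign_mat n x \<in> sign_matrices n"
  by (auto simp: sign_mat_def sign_matrices_def diagonal_mat_def)

text \<open>Multiply A|x| = m x by the sign matrix S of \<open>x\<close>, for which S x =
  |x|.\<close>

lemma aligned_trio_of_eigendirection:
  assumes n: "0 < n" and A: "A \<in> carrier_mat n n"
    and x: "eigendirection n (abs_app n A) m x" and m: "0 \<le> m"
  shows "aligned_trio A m (sign_mat n x) (abs_part n x)"
proof -
  let ?S = "sign_mat n x" and ?v = "abs_part n x"
  have S: "?S \<in> carrier_mat n n" "diagonal_mat ?S"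
    using sign_mat_in[of n x] by (auto simp: sign_matrices_def)
  have v: "?v \<in> carrier_vec n" by (simp add: abs_part_def)
  have "norm_vec ?v = 1"
    using x unfolding eigendirection_def topspace_nsphere_less[OF n]
    by (simp add: norm_vec_def abs_part_def L2_set_def)
  moreover have "0\<^sub>v n \<le> ?v"
    by (simp add: less_eq_vec_def abs_part_def)
  moreover have "(?S * A) *\<^sub>v ?v = m \<cdot>\<^sub>v ?v"
  proof (rule eq_vecI)
    fix i assume "i < dim_vec (m \<cdot>\<^sub>v ?v)"
    then have i: "i < n" using v by simp
    have "((?S * A) *\<^sub>v ?v) $ i = (?S *\<^sub>v (A *\<^sub>v ?v)) $ i"
      using S A v by simp
    also have "\<dots> = ?S $$ (i, i) * (A *\<^sub>v ?v) $ i"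
      using S A v i by (intro diagonal_mat_mult_vec) auto
    also have "(A *\<^sub>v ?v) $ i = m * x i"
      using mat_app_vec[OF A i, of "\<lambda>i. \<bar>x i\<bar>"] x i
      by (simp add: abs_part_def eigendirection_def abs_app_def)
    also have "?S $$ (i, i) * (m * x i) = (m \<cdot>\<^sub>v ?v) $ i"
      using i by (simp add: sign_mat_def abs_part_def)
    finally show "((?S * A) *\<^sub>v ?v) $ i = (m \<cdot>\<^sub>v ?v) $ i" .
  qed (use S A v in auto)
  ultimately show ?thesis
    using m A v sign_mat_in by (simp add: aligned_trio_def)
qed

text \<open>As \<open>v\<close> is nonnegative, x = S v has |x| = v, and S S = 1 gives A v = m S v =
  m x. A zero of \<open>v\<close> would lose the sign in \<open>S\<close>, hence the positivity for
  the last claim.\<close>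

lemma eigendirection_of_aligned_trio:
  assumes n: "0 < n" and A: "A \<in> carrier_mat n n" and T: "aligned_trio A m S v"
  defines "x \<equiv> \<lambda>i. if i < n then S $$ (i, i) * v $ i else 0"
  shows "eigendirection n (abs_app n A) m x" and "abs_part n x = v"
    and "(\<And>i. i < n \<Longrightarrow> 0 < v $ i) \<Longrightarrow> sign_mat n x = S"
proof -
  have S: "S \<in> carrier_mat n n" "diagonal_mat S" and Sii: "\<And>i. i < n \<Longrightarrow> S $$ (i, i) = -1 \<or> S $$ (i, i) = 1"
    and v: "v \<in> carrier_vec n" "0\<^sub>v n \<le> v" "norm_vec v = 1" and ev: "(S * A) *\<^sub>v v = m \<cdot>\<^sub>v v"
    using T A by (auto simp: aligned_trio_def sign_matrices_def)
  have v0: "0 \<le> v $ i" if "i < n" for i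
    using v(1,2) that by (auto simp: less_eq_vec_def)
  have absx: "\<bar>x i\<bar> = v $ i" if "i < n" for i
    using v0[OF that] Sii[OF that] that by (auto simp: x_def abs_mult)
  then show absv: "abs_part n x = v"
    using v(1) by (intro eq_vecI) (auto simp: abs_part_def)
  show "sign_mat n x = S" if pos: "\<And>i. i < n \<Longrightarrow> 0 < v $ i"
  proof (rule eq_matI)
    fix i j assume ij: "i < dim_row S" "j < dim_col S"
    then show "sign_mat n x $$ (i, j) = S $$ (i, j)"
      using S Sii[of i] pos[of i] by (auto simp: sign_mat_def x_def diagonal_mat_def)
  qed (use S in \<open>auto simp: sign_mat_def\<close>)
  have "(\<Sum>i<n. (x i)\<^sup>2) = (\<Sum>i<n. (v $ i)\<^sup>2)"
    using absx by (intro sum.cong) (simp_all flip: absx)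
  also have "\<dots> = (norm_vec v)\<^sup>2"
    using v(1) by (simp add: norm_vec_def L2_set_def sum_nonneg)
  finally have "x \<in> topspace (nsphere (n - 1))"
    unfolding topspace_nsphere_less[OF n] using v(3) by (simp add: x_def)
  moreover have "abs_app n A x i = m * x i" if i: "i < n" for i
  proof -
    have Av: "(A *\<^sub>v v) $ i = abs_app n A x i"
      using mat_app_vec[OF A i, of "\<lambda>i. \<bar>x i\<bar>"] absv by (simp add: abs_part_def abs_app_def)
    have "S $$ (i, i) * (A *\<^sub>v v) $ i = (S *\<^sub>v (A *\<^sub>v v)) $ i"
      using S A v i by (intro diagonal_mat_mult_vec[symmetric]) auto
    also have "\<dots> = ((S * A) *\<^sub>v v) $ i"
      using S A v by simp
    also have "\<dots> = m * v $ i" using ev v i by simp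
    finally have "S $$ (i, i) * abs_app n A x i = m * v $ i" unfolding Av .
    then show ?thesis using Sii[OF i] i by (auto simp: x_def)
  qed
  ultimately show "eigendirection n (abs_app n A) m x"
    by (simp add: eigendirection_def)
qed

lemma aligned_spectrum_eigendirection:
  assumes "0 < n" "A \<in> carrier_mat n n"
  shows "l \<in> aligned_spectrum A \<longleftrightarrow> 0 \<le> l \<and> (\<exists>x. eigendirection n (abs_app n A) l x)"
  using aligned_trio_of_eigendirection[OF assms] eigendirection_of_aligned_trio(1)[OF assms]
    aligned_trio_def[of A l]
  unfolding aligned_spectrum_def by blast

text \<open>Genericity speaks of S A, while the linearization at \<open>x\<close> is A S.
  Conjugation by S, its own inverse, turns one into the other, so their characteristic polynomials
  agree.\<close>

lemma generic_eigendirection: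
  assumes n: "0 < n" and A: "A \<in> carrier_mat n n" and gen: "generic A"
    and x: "eigendirection n (abs_app n A) m x" and m: "0 \<le> m"
  shows "\<And>i. i < n \<Longrightarrow> x i \<noteq> 0"
    and "Polynomial.order m (char_poly (mat n n (\<lambda>(i, j). A $$ (i, j) * sgn (x j)))) = 1"
proof -
  let ?S = "sign_mat n x"
  have T: "aligned_trio A m ?S (abs_part n x)"
    by (rule aligned_trio_of_eigendirection[OF n A x m])
  show nz: "x i \<noteq> 0" if "i < n" for i
    using gen T that unfolding generic_def by (force simp: abs_part_def)
  have S: "?S \<in> carrier_mat n n" "diagonal_mat ?S"
    using sign_mat_in[of n x] by (auto simp: sign_matrices_def)
  have SS: "?S * ?S = 1\<^sub>m n"
  proof (rule eq_matI)
    fix i j assume ij: "i < dim_row (1\<^sub>m n :: real mat)" "j < dim_col (1\<^sub>m n :: real mat)"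
    have "(?S * ?S) $$ (i, j) = (?S *\<^sub>v col ?S j) $ i"
      using S ij by simp
    also have "\<dots> = ?S $$ (i, i) * ?S $$ (i, j)"
      using S ij by (subst diagonal_mat_mult_vec) auto
    also have "\<dots> = 1\<^sub>m n $$ (i, j)"
      using ij by (simp add: sign_mat_def)
    finally show "(?S * ?S) $$ (i, j) = 1\<^sub>m n $$ (i, j)" .
  qed (use S in auto)
  have AS: "A * ?S = mat n n (\<lambda>(i, j). A $$ (i, j) * sgn (x j))"
  proof (rule eq_matI)
    fix i j assume "i < dim_row (mat n n (\<lambda>(i, j). A $$ (i, j) * sgn (x j)))"
      "j < dim_col (mat n n (\<lambda>(i, j). A $$ (i, j) * sgn (x j)))"
    then have ij: "i < n" "j < n" by auto
    have "(A * ?S) $$ (i, j) = (\<Sum>k<n. A $$ (i, k) * ?S $$ (k, j))"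
      using A S ij by (simp add: scalar_prod_def atLeast0LessThan)
    also have "\<dots> = (\<Sum>k<n. if k = j then A $$ (i, k) * sgn (x j) else 0)"
      using ij nz[OF ij(2)] by (intro sum.cong) (auto simp: sign_mat_def sgn_if)
    also have "\<dots> = A $$ (i, j) * sgn (x j)" using ij by simp
    finally show "(A * ?S) $$ (i, j) = mat n n (\<lambda>(i, j). A $$ (i, j) * sgn (x j)) $$ (i, j)"
      using ij by simp
  qed (use A S in auto)
  have "similar_mat_wit (?S * A) (A * ?S) ?S ?S"
    using A S SS by (intro similar_mat_witI[of _ _ n]) (auto simp: assoc_mult_mat[of _ n n _ n _ n])
  then have "char_poly (?S * A) = char_poly (A * ?S)"
    by (intro char_poly_similar) (auto simp: similar_mat_def)
  then show "Polynomial.order m (char_poly (mat n n (\<lambda>(i, j). A $$ (i, j) * sgn (x j)))) = 1"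
    using gen T unfolding generic_def simple_eigenvalue_def AS by metis
qed

section \<open>Counting aligned directions\<close>

lemma card_eigendirections:
  assumes n: "0 < n" and A: "A \<in> carrier_mat n n" and gen: "generic A" and m: "0 \<le> m"
  shows "card {x. eigendirection n (abs_app n A) m x} = aligned_multiplicity A m"
  unfolding aligned_multiplicity_def
proof (rule bij_betw_same_card)
  let ?f = "\<lambda>x. (sign_mat n x, abs_part n x)"
  show "bij_betw ?f {x. eigendirection n (abs_app n A) m x} {(S, v). aligned_trio A m S v}"
    unfolding bij_betw_def
  proof
    show "inj_on ?f {x. eigendirection n (abs_app n A) m x}"
    proof (rule inj_onI, rule ext)
      fix x y i
      assume xy: "x \<in> {x. eigendirection n (abs_app n A) m x}" "y \<in> {x. eigendirection n (abs_app n A) m x}"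
        and eq: "?f x = ?f y"
      show "x i = y i"
      proof (cases "i < n")
        case True
        have "sign_mat n x $$ (i, i) = sign_mat n y $$ (i, i)" "abs_part n x $ i = abs_part n y $ i"
          using eq by auto
        then show ?thesis
          using True by (auto simp: sign_mat_def abs_part_def split: if_splits)
      next
        case False
        then show ?thesis
          using xy unfolding eigendirection_def topspace_nsphere_less[OF n] by auto
      qed
    qed
    show "?f ` {x. eigendirection n (abs_app n A) m x} = {(S, v). aligned_trio A m S v}"
    proof (intro equalityI subsetI)
      fix T assume "T \<in> {(S, v). aligned_trio A m S v}"
      then obtain S v where T: "T = (S, v)" "aligned_trio A m S v" by auto
      \<comment> \<open>Strict positivity from genericity allows \<open>S\<close> to be recovered
        from x = S v.\<close>
      then have "0 < v $ i" if "i < n" for i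
        using gen that A unfolding generic_def aligned_trio_def by (metis carrier_matD(1) carrier_vecD)
      then show "T \<in> ?f ` {x. eigendirection n (abs_app n A) m x}"
        using eigendirection_of_aligned_trio[OF n A T(2)] T(1)
        by (intro image_eqI[where x = "\<lambda>i. if i < n then S $$ (i, i) * v $ i else 0"]) auto
    next
      fix T assume "T \<in> ?f ` {x. eigendirection n (abs_app n A) m x}"
      then show "T \<in> {(S, v). aligned_trio A m S v}"
        using aligned_trio_of_eigendirection[OF n A _ m] by auto
    qed
  qed
qed

text \<open>There are finitely many sign patterns, each makes the map a matrix \<open>B I\<close>
  with finitely many eigenvalues, and a simple eigenvalue leaves only two opposite unit
  vectors.\<close>

lemma finite_eigendirections:
  assumes n: "0 < n" and A: "A \<in> carrier_mat n n" and gen: "generic A"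
  shows "finite {x. \<exists>m>0. eigendirection n (abs_app n A) m x}"
proof -
  define B where "B I = mat n n (\<lambda>(i, j). A $$ (i, j) * (if j \<in> I then -1 else 1))" for I :: "nat set"
  define E where "E I m = {x. eigendirection n (abs_app n A) m x \<and> 0 < m \<and> {i. i < n \<and> x i < 0} = I}" for I m
  have BI: "mat n n (\<lambda>(i, j). A $$ (i, j) * sgn (x j)) = B {i. i < n \<and> x i < 0}"
    and lin: "eigendirection n (mat_app n (B {i. i < n \<and> x i < 0})) m x"
    if x: "eigendirection n (abs_app n A) m x" and m: "0 < m" for x m
  proof -
    have "sgn (x j) = (if j \<in> {i. i < n \<and> x i < 0} then -1 else 1)" if "j < n" for j
      using generic_eigendirection(1)[OF n A gen x _ that] m that by (auto simp: sgn_if)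
    then show eq: "mat n n (\<lambda>(i, j). A $$ (i, j) * sgn (x j)) = B {i. i < n \<and> x i < 0}"
      unfolding B_def by (intro eq_matI) simp_all
    show "eigendirection n (mat_app n (B {i. i < n \<and> x i < 0})) m x"
      using x abs_app_same_signs[of n x x _ A] unfolding eq[symmetric]
      by (simp add: eigendirection_def)
  qed
  have Bc: "B I \<in> carrier_mat n n" for I by (simp add: B_def)
  have "finite (E I m)" for I m
  proof (cases "E I m = {}")
    case False
    then obtain z where z: "z \<in> E I m" by auto
    then have zm: "eigendirection n (abs_app n A) m z" and m: "0 < m" and I: "{i. i < n \<and> z i < 0} = I"
      by (auto simp: E_def)
    have z0: "z 0 \<noteq> 0" and ord: "Polynomial.order m (char_poly (B I)) = 1"
      using generic_eigendirection[OF n A gen zm] m n BI[OF zm m] I by auto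
    have "x = z \<or> x = (\<lambda>i. - z i)" if "x \<in> E I m" for x
    proof -
      have x: "eigendirection n (mat_app n (B I)) m x"
        using that lin[of m x] by (auto simp: E_def)
      show ?thesis
      \<comment> \<open>Only the uniqueness of \<open>z\<close> up to sign is taken from this lemma;
        the bound 1 is arbitrary.\<close>
      proof (rule linear_pencil_toggle[OF n Bc[of I] lin[OF zm m, unfolded I] z0 ord, of 1], goal_cases)
        case (2 \<epsilon>)
        then show ?case using 2(3)[OF x] by simp
      qed simp
    qed
    then have "E I m \<subseteq> {z, (\<lambda>i. - z i)}" by auto
    then show ?thesis by (rule finite_subset) simp
  qed simp
  moreover have "finite {m. poly (char_poly (B I)) m = 0}" for I
    using degree_monic_char_poly[OF Bc[of I]] n by (intro poly_roots_finite) auto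
  ultimately have "finite (\<Union>I\<in>Pow {..<n}. \<Union>m\<in>{m. poly (char_poly (B I)) m = 0}. E I m)"
    by auto
  moreover have "{x. \<exists>m>0. eigendirection n (abs_app n A) m x}
      \<subseteq> (\<Union>I\<in>Pow {..<n}. \<Union>m\<in>{m. poly (char_poly (B I)) m = 0}. E I m)"
  proof
    fix x assume "x \<in> {x. \<exists>m>0. eigendirection n (abs_app n A) m x}"
    then obtain m where x: "eigendirection n (abs_app n A) m x" "0 < m" by auto
    then show "x \<in> (\<Union>I\<in>Pow {..<n}. \<Union>m\<in>{m. poly (char_poly (B I)) m = 0}. E I m)"
      using eigendirection_root[OF n Bc lin[OF x]]
      by (intro UN_I[of "{i. i < n \<and> x i < 0}"] UN_I[of m]) (auto simp: E_def)
  qed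
  ultimately show ?thesis by (rule finite_subset[rotated])
qed

text \<open>Directions with different eigenvalues are disjoint, so the multiplicities add up. The
  set on the right is the one the parity lemma yields for the multiplier 1.\<close>

lemma aligned_count_eigendirections:
  assumes n: "0 < n" and A: "A \<in> carrier_mat n n" and gen: "generic A"
  shows "aligned_count A = card {x. \<exists>m>0. eigendirection n (abs_app n A) m x \<and> 1 < m}"
proof -
  define P where "P m = {x. eigendirection n (abs_app n A) m x}" for m
  define L where "L = {l \<in> aligned_spectrum A. 1 < l}"
  define Q where "Q = {x. \<exists>m>0. eigendirection n (abs_app n A) m x}"
  have finQ: "finite Q"
    unfolding Q_def by (rule finite_eigendirections[OF n A gen])
  have L: "l \<in> L \<longleftrightarrow> 1 < l \<and> P l \<noteq> {}" for l
    using aligned_spectrum_eigendirection[OF n A, of l] by (auto simp: L_def P_def)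
  have PQ: "P m \<subseteq> Q" if "1 < m" for m
  proof
    fix x assume "x \<in> P m"
    moreover have "0 < m" using that by simp
    ultimately show "x \<in> Q" unfolding P_def Q_def by blast
  qed
  have unique: "l = l'" if "x \<in> P l" "x \<in> P l'" for l l' x
    using that eigendirection_unique[OF n] unfolding P_def by blast
  have U: "{x. \<exists>m>0. eigendirection n (abs_app n A) m x \<and> 1 < m} = (\<Union>l\<in>L. P l)"
  proof (intro equalityI subsetI)
    fix x assume "x \<in> {x. \<exists>m>0. eigendirection n (abs_app n A) m x \<and> 1 < m}"
    then obtain m where "1 < m" "x \<in> P m" unfolding P_def by blast
    then show "x \<in> (\<Union>l\<in>L. P l)" using L by blast
  next
    fix x assume "x \<in> (\<Union>l\<in>L. P l)"
    then obtain l where l: "1 < l" "x \<in> P l" using L by blast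
    then have "0 < l" by simp
    with l show "x \<in> {x. \<exists>m>0. eigendirection n (abs_app n A) m x \<and> 1 < m}"
      unfolding P_def by blast
  qed
  \<comment> \<open>Each direction has a single eigenvalue, so \<open>L\<close> is covered by the
    image of the finite set \<open>Q\<close>.\<close>
  have "L \<subseteq> (\<lambda>x. THE m. x \<in> P m) ` Q"
  proof
    fix l assume "l \<in> L"
    then obtain x where x: "1 < l" "x \<in> P l" using L by blast
    then have "(THE m. x \<in> P m) = l"
      using unique by (intro the_equality) auto
    then show "l \<in> (\<lambda>x. THE m. x \<in> P m) ` Q"
      using x PQ by blast
  qed
  then have "finite L" using finQ by (rule finite_surj[rotated])
  moreover have "\<forall>l\<in>L. finite (P l)"
    using L finite_subset[OF PQ finQ] by simp
  moreover have "\<forall>l\<in>L. \<forall>l'\<in>L. l \<noteq> l' \<longrightarrow> P l \<inter> P l' = {}"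
    using unique by blast
  ultimately have "card (\<Union>l\<in>L. P l) = (\<Sum>l\<in>L. card (P l))"
    by (rule card_UN_disjoint)
  also have "\<dots> = aligned_count A"
    unfolding aligned_count_def L_def[symmetric]
    by (intro sum.cong) (use L card_eigendirections[OF n A gen] P_def in \<open>auto simp: P_def\<close>)
  finally show ?thesis using U by simp
qed

section \<open>The field of \<open>F_map\<close> and its degree\<close>

lemma F_map_pencil:
  assumes "A \<in> carrier_mat n n" "i < n"
  shows "F_map A (Matrix.vec n x) $ i = pencil (abs_app n A) (\<lambda>_. 1) x i"
proof -
  have "abs_vec (Matrix.vec n x) = Matrix.vec n (\<lambda>i. \<bar>x i\<bar>)"
    by (auto simp: abs_vec_def)
  then show ?thesis
    using assms mat_app_vec[OF assms, of "\<lambda>i. \<bar>x i\<bar>"]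
    by (simp add: F_map_def pencil_def abs_app_def del: index_mult_mat_vec)
qed

text \<open>The two normalizations agree even at a zero of the field, where division by zero makes
  both 0.\<close>

lemma deg_F_field_degree:
  assumes A: "A \<in> carrier_mat n n"
  shows "deg_F A = field_degree n (pencil (abs_app n A) (\<lambda>_. 1))"
proof -
  have "F_sphere A x = normalized n (pencil (abs_app n A) (\<lambda>_. 1) x)" for x
  proof -
    have d: "dim_vec (F_map A (Matrix.vec n x)) = n"
      using A by (simp add: F_map_def)
    have "norm_vec (F_map A (Matrix.vec n x)) = L2_set (pencil (abs_app n A) (\<lambda>_. 1) x) {..<n}"
      unfolding norm_vec_def d by (intro L2_set_cong) (simp_all add: F_map_pencil[OF A])
    then show ?thesis
      using A d by (auto simp: F_sphere_def F_bar_def coords_def normalized_def F_map_pencil[OF A])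
  qed
  then have "F_sphere A = (\<lambda>x. normalized n (pencil (abs_app n A) (\<lambda>_. 1) x))" by blast
  then show ?thesis
    using A by (simp add: deg_F_def field_degree_def)
qed

text \<open>A nonzero zero of \<open>F_map A\<close> satisfies A|z| = z, and this survives scaling
  to unit length, which makes 1 an aligned value.\<close>

lemma nondegenerate_if_one_not_aligned:
  assumes n: "0 < n" and A: "A \<in> carrier_mat n n" and spec: "1 \<notin> aligned_spectrum A"
  shows "nondegenerate A"
  unfolding nondegenerate_def
proof (intro ballI impI)
  fix z assume "z \<in> carrier_vec (dim_row A)" and F: "F_map A z = 0\<^sub>v (dim_row A)"
  then have z: "z \<in> carrier_vec n" using A by simp
  define y where "y = ($) z"
  have zy: "z = Matrix.vec n y" using z by (auto simp: y_def)
  have Ay: "abs_app n A y i = y i" if "i < n" for i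
    using F_map_pencil[OF A that, of y] F A that by (simp add: zy pencil_def)
  show "z = 0\<^sub>v (dim_row A)"
  proof (rule ccontr)
    assume "z \<noteq> 0\<^sub>v (dim_row A)"
    then have nz: "\<exists>i<n. y i \<noteq> 0" using A by (auto simp: zy vec_eq_iff)
    then have r: "0 < L2_set y {..<n}" by (rule L2_set_pos)
    have "abs_app n A (normalized n y) i = normalized n y i" if "i < n" for i
    proof -
      have "abs_app n A (normalized n y) i = (\<Sum>j<n. A $$ (i, j) * \<bar>y j\<bar> / L2_set y {..<n})"
        unfolding abs_app_def mat_app_def using r by (intro sum.cong) (auto simp: normalized_def)
      also have "\<dots> = abs_app n A y i / L2_set y {..<n}"
        by (simp add: abs_app_def mat_app_def sum_divide_distrib)
      finally show ?thesis using that by (simp add: Ay normalized_def)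
    qed
    then have "eigendirection n (abs_app n A) 1 (normalized n y)"
      using normalized_in_nsphere[OF nz] by (simp add: eigendirection_def)
    then show False
      using spec aligned_spectrum_eigendirection[OF n A, of 1] by auto
  qed
qed

theorem theorem1p1:
  fixes n :: nat and A :: "real mat"
  assumes "0 < n"
    and "A \<in> carrier_mat n n"
    and "generic A"
    and "1 \<notin> aligned_spectrum A"
  shows "nondegenerate A
    \<and> [deg_F A = 1 + int (aligned_count A)] (mod 2)
    \<and> ((\<forall>l\<in>aligned_spectrum A. l < 1) \<longrightarrow> deg_F A = 1)
    \<and> ((\<forall>l\<in>aligned_spectrum A. 1 < l) \<longrightarrow> deg_F A = 0)"
proof (intro conjI impI)
  note n = assms(1) and A = assms(2) and gen = assms(3)
  let ?g = "abs_app n A"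
  have spec: "l \<in> aligned_spectrum A \<longleftrightarrow> 0 \<le> l \<and> (\<exists>x. eigendirection n ?g l x)" for l
    by (rule aligned_spectrum_eigendirection[OF n A])
  have ne: "1 \<noteq> m" if "eigendirection n ?g m x" for m x
    using that spec[of 1] assms(4) by auto
  show "nondegenerate A" by (rule nondegenerate_if_one_not_aligned[OF n A assms(4)])
  have "even (field_degree n (pencil ?g (\<lambda>_. 1)) - 1
      - int (card {x. \<exists>m>0. eigendirection n ?g m x \<and> 1 < m}))"
    using generic_eigendirection[OF n A gen] ne
    by (intro field_degree_pencil_parity[OF n finite_eigendirections[OF n A gen]]) (auto simp: less_imp_le)
  then have "even (deg_F A - (1 + int (aligned_count A)))"
    by (simp add: deg_F_field_degree[OF A] aligned_count_eigendirections[OF n A gen] algebra_simps)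
  then show "[deg_F A = 1 + int (aligned_count A)] (mod 2)"
    by (simp add: cong_iff_dvd_diff)
  show "deg_F A = 1" if less: "\<forall>l\<in>aligned_spectrum A. l < 1"
    unfolding deg_F_field_degree[OF A]
  proof (rule field_degree_pencil_above[OF n coordinatewise_continuous_abs_app])
    fix x m assume "eigendirection n ?g m x"
    \<comment> \<open>The aligned spectrum contains only the nonnegative eigenvalues; negative ones
      are below 1 anyway.\<close>
    then show "m < 1" using less spec[of m] by (cases "0 \<le> m") auto
  qed simp
  show "deg_F A = 0" if "\<forall>l\<in>aligned_spectrum A. 1 < l"
    unfolding deg_F_field_degree[OF A]
    using that spec by (intro field_degree_pencil_below[OF n A]) blast
qed

end
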